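(* Suppose $F$ is a field of characteristic different from $2$ and $3$, and $E : y^2 = x^3 + ax + b$ is an elliptic curve over $F$. If $u, v \in F$, let $\mathcal{E}_{u,v}$ denote the curve $$y^2 = x^3 + 3(3av^2 + 9buv - a^2u^2)x + 27bv^3 - 18a^2uv^2 - 27abu^2v - (2a^3 + 27b^2)u^3.$$ If $E'$ is an elliptic curve over $F$, and $E'[2] \cong E[2]$ as $G_F$-modules, then $E'$ is isomorphic to $\mathcal{E}_{u,v}$ for some $u, v \in F$. Conversely, if $u, v \in F$ and $\mathcal{E}_{u,v}$ is nonsingular, then $\mathcal{E}_{u,v}[2] \cong E[2]$ as $G_F$-modules, $$j(\mathcal{E}_{u,v}) = \frac{(3av^2 + 9buv - a^2u^2)^3\, j(E)}{27a^3(v^3 + au^2v + bu^3)^2},$$ and $$\Delta(\mathcal{E}_{u,v}) = 3^6(v^3 + au^2v + bu^3)^2 \Delta(E).$$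
   Context: $F^{\mathrm{sep}}$ denotes a separable closure of $F$ and $G_F = \mathrm{Gal}(F^{\mathrm{sep}}/F)$. For an elliptic curve $E$ over $F$, $j(E)$ denotes its $j$-invariant, $\Delta(E)$ denotes its discriminant (that of the given Weierstrass equation), and $E[2]$ denotes the $G_F$-module of $2$-torsion points on $E$.
   Formalization: For a = 0 the right-hand side of the j-formula is 0/0, so it is proved as written for a ≠ 0, and for all a with j(E)/a³ replaced by 6912/(4a³+27b²), its value after cancelling a³. *)

theory Defs
  imports
    "HOL-Computational_Algebra.Computational_Algebra"
    "HOL-Algebra.Algebraic_Closure_Type"
begin

section \<open>Separable closures and absolute Galois groups\<close>

definition field_embedding :: "('a::field \<Rightarrow> 'b::field) \<Rightarrow> bool" where
  "field_embedding f \<longleftrightarrow>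
     f 1 = 1 \<and> (\<forall>x y. f (x + y) = f x + f y) \<and> (\<forall>x y. f (x * y) = f x * f y)"

definition separable_poly :: "'a::field poly \<Rightarrow> bool" where
  "separable_poly p \<longleftrightarrow> coprime p (pderiv p)"

text \<open>An irreducible polynomial over the base field that vanishes at \<open>x\<close> is, up to a scalar,
  the minimal polynomial of \<open>x\<close>.\<close>

definition separable_element :: "('a::field \<Rightarrow> 'k::field) \<Rightarrow> 'k \<Rightarrow> bool" where
  "separable_element \<iota> x \<longleftrightarrow>
     (\<exists>p. irreducible p \<and> separable_poly p \<and> poly (map_poly \<iota> p) x = 0)"

text \<open>The type \<open>'k\<close>, viewed as an extension of \<open>'a\<close> via \<open>\<iota>\<close>, is a separable closure of \<open>'a\<close>:
  it is separable algebraic over \<open>'a\<close> and separably closed.\<close>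

definition separable_closure :: "('a::field \<Rightarrow> 'k::field) \<Rightarrow> bool" where
  "separable_closure \<iota> \<longleftrightarrow>
     field_embedding \<iota> \<and>
     (\<forall>x. separable_element \<iota> x) \<and>
     (\<forall>p :: 'k poly. degree p > 0 \<longrightarrow> separable_poly p \<longrightarrow> (\<exists>x. poly p x = 0))"

definition galois_group :: "('a::field \<Rightarrow> 'k::field) \<Rightarrow> ('k \<Rightarrow> 'k) set" where
  "galois_group \<iota> = {\<sigma>. field_embedding \<sigma> \<and> bij \<sigma> \<and> (\<forall>c. \<sigma> (\<iota> c) = \<iota> c)}"


section \<open>Weierstrass curves\<close>

text \<open>\<open>Weierstrass a\<^sub>1 a\<^sub>2 a\<^sub>3 a\<^sub>4 a\<^sub>6\<close> is the curve
  \<open>y\<^sup>2 + a\<^sub>1 x y + a\<^sub>3 y = x\<^sup>3 + a\<^sub>2 x\<^sup>2 + a\<^sub>4 x + a\<^sub>6\<close>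
  together with its point at infinity. Base change along \<open>f\<close>
  is the datatype map function \<open>map_weierstrass f\<close>.\<close>

datatype 'a weierstrass =
  Weierstrass (wa1: 'a) (wa2: 'a) (wa3: 'a) (wa4: 'a) (wa6: 'a)

definition short_weierstrass :: "'a::field \<Rightarrow> 'a \<Rightarrow> 'a weierstrass" where
  "short_weierstrass a b = Weierstrass 0 0 0 a b"

definition on_curve :: "'a::field weierstrass \<Rightarrow> 'a \<Rightarrow> 'a \<Rightarrow> bool" where
  "on_curve W x y \<longleftrightarrow>
     y^2 + wa1 W * x * y + wa3 W * y = x^3 + wa2 W * x^2 + wa4 W * x + wa6 W"

text \<open>Both partial derivatives of the defining polynomial vanish at the point.\<close>

definition singular_point :: "'a::field weierstrass \<Rightarrow> 'a \<Rightarrow> 'a \<Rightarrow> bool" where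
  "singular_point W x y \<longleftrightarrow> on_curve W x y \<and>
     wa1 W * y - (3 * x^2 + 2 * wa2 W * x + wa4 W) = 0 \<and>
     2 * y + wa1 W * x + wa3 W = 0"

text \<open>Singular points are looked for over an algebraic closure of the field of definition. The
  point at infinity of a Weierstrass curve is never singular. A Weierstrass curve is an elliptic
  curve iff it is nonsingular.\<close>

definition nonsingular :: "'a::field weierstrass \<Rightarrow> bool" where
  "nonsingular W \<longleftrightarrow> (\<nexists>x y. singular_point (map_weierstrass to_ac W) x y)"

definition wb2 :: "'a::field weierstrass \<Rightarrow> 'a" where
  "wb2 W = wa1 W^2 + 4 * wa2 W"

definition wb4 :: "'a::field weierstrass \<Rightarrow> 'a" where
  "wb4 W = 2 * wa4 W + wa1 W * wa3 W"

definition wb6 :: "'a::field weierstrass \<Rightarrow> 'a" where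
  "wb6 W = wa3 W^2 + 4 * wa6 W"

definition wb8 :: "'a::field weierstrass \<Rightarrow> 'a" where
  "wb8 W = wa1 W^2 * wa6 W + 4 * wa2 W * wa6 W - wa1 W * wa3 W * wa4 W
           + wa2 W * wa3 W^2 - wa4 W^2"

definition wc4 :: "'a::field weierstrass \<Rightarrow> 'a" where
  "wc4 W = wb2 W^2 - 24 * wb4 W"

definition discriminant :: "'a::field weierstrass \<Rightarrow> 'a" where
  "discriminant W = - (wb2 W^2 * wb8 W) - 8 * wb4 W^3 - 27 * wb6 W^2 + 9 * wb2 W * wb4 W * wb6 W"

definition j_invariant :: "'a::field weierstrass \<Rightarrow> 'a" where
  "j_invariant W = wc4 W^3 / discriminant W"

text \<open>Isomorphism over the field of definition of curves given by Weierstrass equations: the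
  substitution \<open>x = u\<^sup>2 x' + r\<close>, \<open>y = u\<^sup>3 y' + s u\<^sup>2 x' + t\<close> with \<open>u \<noteq> 0\<close> turns the equation of \<open>W\<close>
  into \<open>u\<^sup>6\<close> times that of \<open>W'\<close>; see \<open>weierstrass_substitution\<close> below. These substitutions are
  precisely the isomorphisms of elliptic curves (as curves with base point at infinity).\<close>

definition weierstrass_iso :: "'a::field weierstrass \<Rightarrow> 'a weierstrass \<Rightarrow> bool" where
  "weierstrass_iso W W' \<longleftrightarrow> (\<exists>u r s t. u \<noteq> 0 \<and>
     u * wa1 W' = wa1 W + 2 * s \<and>
     u^2 * wa2 W' = wa2 W - s * wa1 W + 3 * r - s^2 \<and>
     u^3 * wa3 W' = wa3 W + r * wa1 W + 2 * t \<and>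
     u^4 * wa4 W' = wa4 W - s * wa3 W + 2 * r * wa2 W - (t + r * s) * wa1 W
                    + 3 * r^2 - 2 * s * t \<and>
     u^6 * wa6 W' = wa6 W + r * wa4 W + r^2 * wa2 W + r^3 - t * wa3 W - t^2 - r * t * wa1 W)"

lemma weierstrass_substitution:
  fixes W W' :: "'a::field weierstrass"
  defines "G \<equiv> \<lambda>W x y. y^2 + wa1 W * x * y + wa3 W * y
                        - (x^3 + wa2 W * x^2 + wa4 W * x + wa6 W)"
  assumes "u * wa1 W' = wa1 W + 2 * s"
    and "u^2 * wa2 W' = wa2 W - s * wa1 W + 3 * r - s^2"
    and "u^3 * wa3 W' = wa3 W + r * wa1 W + 2 * t"
    and "u^4 * wa4 W' = wa4 W - s * wa3 W + 2 * r * wa2 W - (t + r * s) * wa1 W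
                        + 3 * r^2 - 2 * s * t"
    and "u^6 * wa6 W' = wa6 W + r * wa4 W + r^2 * wa2 W + r^3 - t * wa3 W - t^2 - r * t * wa1 W"
  shows "G W (u^2 * x + r) (u^3 * y + s * u^2 * x + t) = u^6 * G W' x y"
proof -
  have "u^6 * G W' x y = u^6 * y^2 + u^5 * (u * wa1 W') * x * y + u^3 * (u^3 * wa3 W') * y
      - (u^6 * x^3 + u^4 * (u^2 * wa2 W') * x^2 + u^2 * (u^4 * wa4 W') * x + u^6 * wa6 W')"
    unfolding G_def by (simp add: algebra_simps eval_nat_numeral)
  also have "\<dots> = G W (u^2 * x + r) (u^3 * y + s * u^2 * x + t)"
    unfolding assms(2-) unfolding G_def by (simp add: algebra_simps eval_nat_numeral)
  finally show ?thesis ..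
qed


section \<open>The group law and the 2-torsion module\<close>

datatype 'a point = Infinity | Affine 'a 'a

definition curve_points :: "'a::field weierstrass \<Rightarrow> 'a point set" where
  "curve_points W = insert Infinity {Affine x y | x y. on_curve W x y}"

fun point_add :: "'a::field weierstrass \<Rightarrow> 'a point \<Rightarrow> 'a point \<Rightarrow> 'a point" where
  "point_add W Infinity Q = Q"
| "point_add W P Infinity = P"
| "point_add W (Affine x1 y1) (Affine x2 y2) =
     (if x1 = x2 \<and> y1 = - y2 - wa1 W * x2 - wa3 W then Infinity
      else
        let l = (if x1 = x2
                 then (3 * x1^2 + 2 * wa2 W * x1 + wa4 W - wa1 W * y1)
                      / (2 * y1 + wa1 W * x1 + wa3 W)
                 else (y2 - y1) / (x2 - x1));
            x3 = l^2 + wa1 W * l - wa2 W - x1 - x2;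
            y3 = - (l * (x3 - x1) + y1) - wa1 W * x3 - wa3 W
        in Affine x3 y3)"

text \<open>The 2-torsion points with coordinates in \<open>'k\<close> of a curve over \<open>'a\<close>.\<close>

definition two_torsion :: "('a::field \<Rightarrow> 'k::field) \<Rightarrow> 'a weierstrass \<Rightarrow> 'k point set" where
  "two_torsion \<iota> W =
     {P \<in> curve_points (map_weierstrass \<iota> W). point_add (map_weierstrass \<iota> W) P P = Infinity}"

text \<open>Isomorphism of Galois modules; the Galois group acts on points coordinatewise.\<close>

definition two_torsion_iso ::
    "('a::field \<Rightarrow> 'k::field) \<Rightarrow> 'a weierstrass \<Rightarrow> 'a weierstrass \<Rightarrow> bool" where
  "two_torsion_iso \<iota> W W' \<longleftrightarrow> (\<exists>\<phi>.
     bij_betw \<phi> (two_torsion \<iota> W) (two_torsion \<iota> W') \<and>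
     (\<forall>P \<in> two_torsion \<iota> W. \<forall>Q \<in> two_torsion \<iota> W.
        \<phi> (point_add (map_weierstrass \<iota> W) P Q)
          = point_add (map_weierstrass \<iota> W') (\<phi> P) (\<phi> Q)) \<and>
     (\<forall>\<sigma> \<in> galois_group \<iota>. \<forall>P \<in> two_torsion \<iota> W.
        \<phi> (map_point \<sigma> P) = map_point \<sigma> (\<phi> P)))"


section \<open>The family\<close>

definition mod2_family :: "'a::field \<Rightarrow> 'a \<Rightarrow> 'a \<Rightarrow> 'a \<Rightarrow> 'a weierstrass" where
  "mod2_family a b u v = short_weierstrass
     (3 * (3 * a * v^2 + 9 * b * u * v - a^2 * u^2))
     (27 * b * v^3 - 18 * a^2 * u * v^2 - 27 * a * b * u^2 * v - (2 * a^3 + 27 * b^2) * u^3)"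

lemma discriminant_short_weierstrass:
  "discriminant (short_weierstrass a b) = - 16 * (4 * a^3 + 27 * b^2)"
  unfolding discriminant_def short_weierstrass_def wb2_def wb4_def wb6_def wb8_def
  by (simp add: power_mult_distrib)

text \<open>The quotient \<open>j(E) / a\<^sup>3\<close> for \<open>E : y\<^sup>2 = x\<^sup>3 + a x + b\<close>, with the factor \<open>a\<^sup>3\<close> of
  \<open>j(E) = 6912 a\<^sup>3 / (4 a\<^sup>3 + 27 b\<^sup>2)\<close> cancelled, so that it also makes sense for \<open>a = 0\<close>.\<close>

definition j_over_a_cubed :: "'a::field \<Rightarrow> 'a \<Rightarrow> 'a" where
  "j_over_a_cubed a b = 6912 / (4 * a^3 + 27 * b^2)"

lemma j_over_a_cubed:
  fixes a b :: "'a::field"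
  assumes "(2::'a) \<noteq> 0" "a \<noteq> 0"
  shows "j_over_a_cubed a b = j_invariant (short_weierstrass a b) / a^3"
proof -
  have [simp]: "(16::'a) \<noteq> 0"
    using assms(1) power_not_zero[of "2::'a" 4] by simp
  have "wc4 (short_weierstrass a b) ^ 3 = -16 * 6912 * a^3"
    unfolding wc4_def wb2_def wb4_def short_weierstrass_def by (simp add: power_mult_distrib)
  hence "j_invariant (short_weierstrass a b)
           = (-16 * (6912 * a^3)) / (-16 * (4 * a^3 + 27 * b^2))"
    unfolding j_invariant_def discriminant_short_weierstrass by (simp add: mult.assoc)
  also have "\<dots> = 6912 * a^3 / (4 * a^3 + 27 * b^2)"
    by (rule mult_divide_mult_cancel_left) simp
  finally show ?thesis
    using assms(2) by (simp add: j_over_a_cubed_def)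
qed

end

theory Submission
  imports Defs
begin

text \<open>Let \<open>e\<close> range over the roots of \<open>x\<^sup>3 + a x + b\<close> in the separable closure; the nonzero 2-torsion points of
  \<open>E\<close> are the points \<open>(e, 0)\<close>. The family is made so that the cubic of \<open>\<E>\<^bsub>u,v\<^esub>\<close> has the roots
  \<open>h e = 3 v e + 3 u e\<^sup>2 + 2 a u\<close> (\<open>mod2_family_coefficients\<close>), which is the general quadratic polynomial
  in \<open>e\<close> whose values at the three roots sum to zero. Everything follows from this.

  If the cubic of \<open>\<E>\<^bsub>u,v\<^esub>\<close> has distinct roots, then \<open>h\<close> is a bijection between the roots of the two cubics. It
  commutes with the Galois action because its coefficients lie in \<open>F\<close>, and any bijection of the nonzero
  2-torsion points is additive, as the sum of two of them is the third; see
  \<open>mod2_family_two_torsion_iso\<close>. The discriminant formula holds because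
  \<open>h e - h e' = 3 (e - e') (v - u e'')\<close>, where \<open>e''\<close> is the third root, and the product of the factors
  \<open>v - u e''\<close> is \<open>v\<^sup>3 + a u\<^sup>2 v + b u\<^sup>3\<close>. The formula for \<open>j\<close> is then a division.

  Conversely, an isomorphism \<open>E'[2] \<cong> E[2]\<close> gives an equivariant map \<open>g\<close> from the roots of the cubic of \<open>E\<close>
  to those of a short Weierstrass model of \<open>E'\<close>. By Lagrange interpolation and because the values of \<open>g\<close>
  sum to zero, \<open>g = h\<close> for unique \<open>u\<close> and \<open>v\<close> in the separable closure. Uniqueness and equivariance make
  \<open>u\<close> and \<open>v\<close> invariant under the Galois group, hence they lie in \<open>F\<close>
  (\<open>equivariant_root_map_is_tschirnhaus\<close>), and the short model of \<open>E'\<close> is equal to \<open>\<E>\<^bsub>u,v\<^esub>\<close>.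

  The last step needs the Galois correspondence for the separable closure: an element fixed by all
  automorphisms over \<open>F\<close> lies in \<open>F\<close> (\<open>galois_group_fixed_field\<close>). An element outside \<open>F\<close> has another
  conjugate; sending it there is a partial automorphism, and Zorn's lemma extends that to the
  whole field (\<open>partial_embedding_extends\<close>).\<close>

section \<open>Separable polynomials and field embeddings\<close>

lemma bezout_poly:
  fixes p q :: "'a::field poly"
  shows "\<exists>s t. (s * p + t * q) dvd p \<and> (s * p + t * q) dvd q"
proof (induction "euclidean_size q" arbitrary: p q rule: less_induct)
  case less
  show ?case
  proof (cases "q = 0")
    case True
    then have "(1 * p + 0 * q) dvd p \<and> (1 * p + 0 * q) dvd q"
      by simp
    then show ?thesis by blast
  next
    case False
    then have "euclidean_size (p mod q) < euclidean_size q"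
      by (rule mod_size_less)
    then obtain s t where st: "(s * q + t * (p mod q)) dvd q" "(s * q + t * (p mod q)) dvd p mod q"
      using less by blast
    have "s * q + t * (p mod q) = t * p + (s - t * (p div q)) * q"
      by (simp add: minus_div_mult_eq_mod[symmetric] algebra_simps)
    moreover have "(s * q + t * (p mod q)) dvd p"
      using st by (metis dvd_mod_imp_dvd)
    ultimately show ?thesis
      using st by metis
  qed
qed

text \<open>A Bezout identity survives every field extension, which is how separability is carried along
  an embedding and down to divisors below.\<close>

lemma separable_poly_bezout:
  "separable_poly p \<longleftrightarrow> (\<exists>s t. s * p + t * pderiv p = 1)"
proof
  assume "separable_poly p"
  then have cop: "coprime p (pderiv p)"
    by (simp add: separable_poly_def)
  obtain s t where "(s * p + t * pderiv p) dvd p" "(s * p + t * pderiv p) dvd pderiv p"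
    using bezout_poly[of p "pderiv p"] by blast
  with cop have "is_unit (s * p + t * pderiv p)"
    by (rule coprime_common_divisor)
  then obtain w where "1 = (s * p + t * pderiv p) * w"
    by (elim dvdE)
  then have "(w * s) * p + (w * t) * pderiv p = 1"
    by (simp add: algebra_simps)
  then show "\<exists>s t. s * p + t * pderiv p = 1"
    by blast
next
  assume "\<exists>s t. s * p + t * pderiv p = 1"
  then show "separable_poly p"
    unfolding separable_poly_def coprime_def by (metis dvd_add dvd_mult)
qed

lemma separable_poly_dvd:
  assumes "separable_poly q" "p dvd q"
  shows "separable_poly p"
proof -
  obtain r where q: "q = p * r"
    using assms(2) by (elim dvdE)
  obtain s t where "s * q + t * pderiv q = 1"
    using assms(1) by (auto simp: separable_poly_bezout)
  then have "(s * r + t * pderiv r) * p + (t * r) * pderiv p = 1"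
    by (simp add: q pderiv_mult algebra_simps)
  then show ?thesis
    unfolding separable_poly_bezout by blast
qed

lemma separable_poly_simple_root:
  assumes "separable_poly p" "poly p x = 0"
  shows "poly (pderiv p) x \<noteq> 0"
proof
  assume "poly (pderiv p) x = 0"
  obtain s t where "s * p + t * pderiv p = 1"
    using assms(1) by (auto simp: separable_poly_bezout)
  then have "poly (s * p + t * pderiv p) x = 1"
    by simp
  with \<open>poly (pderiv p) x = 0\<close> assms(2) show False
    by simp
qed

context
  fixes f :: "'a::field \<Rightarrow> 'b::field"
  assumes f: "field_embedding f"
begin

lemma field_embedding_1: "f 1 = 1"
  and field_embedding_add: "f (x + y) = f x + f y"
  and field_embedding_mult: "f (x * y) = f x * f y"
  using f by (auto simp: field_embedding_def)

lemma field_embedding_0: "f 0 = 0"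
  using field_embedding_add[of 0 0] by (metis add_cancel_right_right)

lemma field_embedding_minus: "f (- x) = - f x"
  using field_embedding_add[of x "- x"] by (simp add: field_embedding_0 eq_neg_iff_add_eq_0 add.commute)

lemma field_embedding_diff: "f (x - y) = f x - f y"
  using field_embedding_add[of x "- y"] by (simp add: field_embedding_minus)

lemma field_embedding_power: "f (x ^ n) = f x ^ n"
  by (induction n) (simp_all add: field_embedding_1 field_embedding_mult)

lemma field_embedding_numeral: "f (numeral n) = numeral n"
proof -
  have "f (of_nat k) = of_nat k" for k
    by (induction k) (simp_all add: field_embedding_0 field_embedding_1 field_embedding_add)
  from this[of "numeral n"] show ?thesis by simp
qed

lemma field_embedding_eq_0_iff: "f x = 0 \<longleftrightarrow> x = 0"
proof
  assume "f x = 0"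
  show "x = 0"
  proof (rule ccontr)
    assume "x \<noteq> 0"
    then have "f (x * inverse x) = 1"
      by (simp add: field_embedding_1)
    with \<open>f x = 0\<close> show False
      unfolding field_embedding_mult by simp
  qed
qed (simp add: field_embedding_0)

lemma field_embedding_eq_iff: "f x = f y \<longleftrightarrow> x = y"
  using field_embedding_eq_0_iff[of "x - y"] by (simp add: field_embedding_diff)

lemmas field_embedding_simps =
  field_embedding_0 field_embedding_1 field_embedding_add field_embedding_mult
  field_embedding_minus field_embedding_diff field_embedding_power field_embedding_numeral

lemma map_poly_embedding_add: "map_poly f (p + q) = map_poly f p + map_poly f q"
  by (intro poly_eqI) (simp add: coeff_map_poly field_embedding_simps)

lemma field_embedding_sum: "f (sum g A) = (\<Sum>i\<in>A. f (g i))"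
  by (induction A rule: infinite_finite_induct) (simp_all add: field_embedding_simps)

lemma map_poly_embedding_mult: "map_poly f (p * q) = map_poly f p * map_poly f q"
  by (intro poly_eqI)
     (simp add: coeff_map_poly field_embedding_simps coeff_mult field_embedding_sum)

lemma field_embedding_of_nat: "f (of_nat k) = of_nat k"
  by (induction k) (simp_all add: field_embedding_simps)

lemma map_poly_embedding_pderiv: "map_poly f (pderiv p) = pderiv (map_poly f p)"
  by (intro poly_eqI)
     (simp add: coeff_map_poly field_embedding_simps coeff_pderiv field_embedding_of_nat del: of_nat_Suc)

lemma separable_poly_map_poly:
  assumes "separable_poly p"
  shows "separable_poly (map_poly f p)"
proof -
  obtain s t where "s * p + t * pderiv p = 1"
    using assms by (auto simp: separable_poly_bezout)
  then have "map_poly f (s * p + t * pderiv p) = 1"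
    by (simp add: field_embedding_1)
  then show ?thesis
    unfolding separable_poly_bezout map_poly_embedding_add map_poly_embedding_mult
      map_poly_embedding_pderiv by blast
qed

end

section \<open>The fixed field of the absolute Galois group\<close>

text \<open>A field homomorphism over \<open>\<iota>\<close> from an intermediate field into the whole field, given by its graph: a
  subring of the square of the field that contains the diagonal of the base field and is single
  valued. The domain is a subring; when the extension is algebraic, this makes it a subfield
  (\<open>graph_inverse\<close>). With graphs, extending a map means enlarging a set, so Zorn's lemma applies to
  inclusion.\<close>

definition partial_embedding :: "('a::field \<Rightarrow> 'k::field) \<Rightarrow> ('k \<times> 'k) set \<Rightarrow> bool" where
  "partial_embedding \<iota> G \<longleftrightarrow>
     (\<forall>c. (\<iota> c, \<iota> c) \<in> G) \<and>
     (\<forall>x y x' y'. (x, y) \<in> G \<longrightarrow> (x', y') \<in> G \<longrightarrow> (x + x', y + y') \<in> G \<and> (x * x', y * y') \<in> G) \<and>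
     (\<forall>y. (0, y) \<in> G \<longrightarrow> y = 0)"

text \<open>Pairs of a polynomial over the domain of the partial map and its image under that map.\<close>

definition graph_polys :: "('k::field \<times> 'k) set \<Rightarrow> ('k poly \<times> 'k poly) set" where
  "graph_polys G = {(p, q). \<forall>n. (coeff p n, coeff q n) \<in> G}"

lemma graph_polysD: "(p, q) \<in> graph_polys G \<Longrightarrow> (coeff p n, coeff q n) \<in> G"
  by (simp add: graph_polys_def)

context
  fixes \<iota> :: "'a::field \<Rightarrow> 'k::field" and G
  assumes emb: "field_embedding \<iota>" and G: "partial_embedding \<iota> G"
begin

lemma graph_base: "(\<iota> c, \<iota> c) \<in> G"
  and graph_add: "(x, y) \<in> G \<Longrightarrow> (x', y') \<in> G \<Longrightarrow> (x + x', y + y') \<in> G"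
  and graph_mult: "(x, y) \<in> G \<Longrightarrow> (x', y') \<in> G \<Longrightarrow> (x * x', y * y') \<in> G"
  and graph_0D: "(0, y) \<in> G \<Longrightarrow> y = 0"
  using G unfolding partial_embedding_def by blast+

lemma graph_0: "(0, 0) \<in> G" and graph_1: "(1, 1) \<in> G"
  using graph_base[of 0] graph_base[of 1] by (simp_all add: field_embedding_simps[OF emb])

lemma graph_minus: "(x, y) \<in> G \<Longrightarrow> (- x, - y) \<in> G"
  using graph_mult[OF graph_base[of "-1"], of x y] by (simp add: field_embedding_simps[OF emb])

lemma graph_diff: "(x, y) \<in> G \<Longrightarrow> (x', y') \<in> G \<Longrightarrow> (x - x', y - y') \<in> G"
  using graph_add[OF _ graph_minus[of x' y'], of x y] by simp

lemma graph_unique: "(x, y) \<in> G \<Longrightarrow> (x, y') \<in> G \<Longrightarrow> y = y'"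
  using graph_diff[of x y x y'] graph_0D[of "y - y'"] by simp

lemma graph_sum: "(\<And>i. i \<in> A \<Longrightarrow> (g i, h i) \<in> G) \<Longrightarrow> (sum g A, sum h A) \<in> G"
  by (induction A rule: infinite_finite_induct) (auto intro: graph_0 graph_add)

lemma graph_polys_0: "(0, 0) \<in> graph_polys G"
  by (simp add: graph_polys_def graph_0)

lemma graph_polys_const: "(x, y) \<in> G \<Longrightarrow> ([:x:], [:y:]) \<in> graph_polys G"
  by (auto simp: graph_polys_def coeff_pCons graph_0 split: nat.split)

lemma graph_polys_X: "([:0, 1:], [:0, 1:]) \<in> graph_polys G"
  by (auto simp: graph_polys_def coeff_pCons graph_0 graph_1 split: nat.split)

lemma graph_polys_add:
  "(p, q) \<in> graph_polys G \<Longrightarrow> (p', q') \<in> graph_polys G \<Longrightarrow> (p + p', q + q') \<in> graph_polys G"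
  by (simp add: graph_polys_def graph_add)

lemma graph_polys_diff:
  "(p, q) \<in> graph_polys G \<Longrightarrow> (p', q') \<in> graph_polys G \<Longrightarrow> (p - p', q - q') \<in> graph_polys G"
  by (simp add: graph_polys_def graph_diff)

lemma graph_polys_mult:
  "(p, q) \<in> graph_polys G \<Longrightarrow> (p', q') \<in> graph_polys G \<Longrightarrow> (p * p', q * q') \<in> graph_polys G"
  by (auto simp: graph_polys_def coeff_mult intro!: graph_sum graph_mult)

lemma graph_polys_monom: "(x, y) \<in> G \<Longrightarrow> (monom x n, monom y n) \<in> graph_polys G"
  by (simp add: graph_polys_def graph_0)

lemma graph_polys_base: "(map_poly \<iota> p, map_poly \<iota> p) \<in> graph_polys G"
  by (simp add: graph_polys_def coeff_map_poly field_embedding_0[OF emb] graph_base)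

lemma graph_poly_eval:
  assumes "(p, q) \<in> graph_polys G" "(x, y) \<in> G"
  shows "(poly p x, poly q y) \<in> G"
  using assms(1)
proof (induction p arbitrary: q)
  case 0
  have "coeff q n = 0" for n
    using graph_polysD[OF 0, of n] graph_0D by simp
  then have "q = 0"
    by (intro poly_eqI) simp
  then show ?case
    by (simp add: graph_0)
next
  case (pCons c p)
  obtain d q' where q: "q = pCons d q'"
    by (cases q)
  have "(c, d) \<in> G"
    using graph_polysD[OF pCons.prems, of 0] by (simp add: q)
  moreover have "(p, q') \<in> graph_polys G"
    using graph_polysD[OF pCons.prems, of "Suc n" for n] by (simp add: q graph_polys_def)
  ultimately show ?case
    using pCons.IH assms(2) by (auto simp: q intro!: graph_add graph_mult)
qed

context
  assumes alg: "\<And>x. separable_element \<iota> x"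
begin

text \<open>If \<open>c + x r(x) = 0\<close> is an equation of \<open>x\<close> over the base field with \<open>c \<noteq> 0\<close>, then \<open>- r(x) / c\<close> is
  the inverse of \<open>x\<close>, and the same expression in \<open>y\<close> is the inverse of \<open>y\<close>.\<close>

lemma graph_inverse:
  assumes "(x, y) \<in> G" "x \<noteq> 0"
  shows "(inverse x, inverse y) \<in> G"
proof -
  obtain p where p: "irreducible p" "poly (map_poly \<iota> p) x = 0"
    using alg[of x] by (auto simp: separable_element_def)
  obtain c r where pr: "p = pCons c r"
    by (cases p)
  have map_p: "map_poly \<iota> p = pCons (\<iota> c) (map_poly \<iota> r)"
    unfolding pr by (simp add: map_poly_pCons field_embedding_0[OF emb])
  have "c \<noteq> 0"
  proof
    assume "c = 0"
    then have "p = [:0, 1:] * r"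
      by (simp add: pr)
    \<comment> \<open>an irreducible multiple of \<open>X\<close> is a constant times \<open>X\<close> and vanishes only at zero\<close>
    then have "is_unit r"
      using irreducibleD[OF p(1), of "[:0,1:]" r] by (auto simp: is_unit_poly_iff)
    then obtain d where d: "r = [:d:]" "d \<noteq> 0"
      by (auto simp: is_unit_poly_iff dvd_field_iff)
    then show False
      using p(2) assms(2) \<open>c = 0\<close>
      by (simp add: map_p map_poly_pCons field_embedding_0[OF emb] field_embedding_eq_0_iff[OF emb])
  qed
  have ev: "(poly (map_poly \<iota> q) x, poly (map_poly \<iota> q) y) \<in> G" for q
    by (rule graph_poly_eval[OF graph_polys_base assms(1)])
  have "poly (map_poly \<iota> p) y = 0"
    using ev[of p] p(2) graph_0D by simp
  then have inv_eq: "inverse z = \<iota> (- inverse c) * poly (map_poly \<iota> r) z" if "z = x \<or> z = y" for z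
  proof -
    have "poly (map_poly \<iota> p) z = 0"
      using that p(2) \<open>poly (map_poly \<iota> p) y = 0\<close> by blast
    then have "\<iota> c + z * poly (map_poly \<iota> r) z = 0"
      by (simp add: map_p)
    then have "z * poly (map_poly \<iota> r) z = - \<iota> c"
      by (simp only: add_eq_0_iff)
    then have "z * (\<iota> (- inverse c) * poly (map_poly \<iota> r) z) = \<iota> (- inverse c) * (- \<iota> c)"
      by (simp only: mult.left_commute[of z])
    also have "\<dots> = \<iota> (inverse c * c)"
      by (simp add: field_embedding_simps[OF emb])
    also have "\<dots> = 1"
      using \<open>c \<noteq> 0\<close> by (simp add: field_embedding_simps[OF emb])
    finally show ?thesis
      by (rule inverse_unique)
  qed
  show ?thesis
    using graph_mult[OF graph_base[of "- inverse c"] ev[of r]] inv_eq[of x] inv_eq[of y] by simp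
qed

lemma graph_0_rightD:
  assumes "(x, 0) \<in> G"
  shows "x = 0"
proof (rule ccontr)
  assume "x \<noteq> 0"
  then have "(x * inverse x, 0 * inverse 0) \<in> G"
    using assms graph_inverse graph_mult by blast
  then show False
    using \<open>x \<noteq> 0\<close> graph_unique[OF _ graph_1, of 0] by simp
qed

lemma graph_polys_eq_0_iff: "(p, q) \<in> graph_polys G \<Longrightarrow> coeff p n = 0 \<longleftrightarrow> coeff q n = 0"
  by (metis graph_polysD graph_0D graph_0_rightD)

lemma graph_polys_degree: 
  assumes "(p, q) \<in> graph_polys G"
  shows "degree p = degree q"
  using graph_polys_eq_0_iff[OF assms] by (simp add: degree_def)

lemma graph_polys_0D: "(0, q) \<in> graph_polys G \<Longrightarrow> q = 0"
  using graph_polys_eq_0_iff[of 0 q] by (simp add: poly_eq_iff)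

text \<open>Division with remainder is carried out with the same steps on a polynomial and on its image, as
  leading coefficients are inverted inside the graph.\<close>

lemma graph_polys_division:
  assumes m: "(m, m') \<in> graph_polys G" "m \<noteq> 0"
    and "(p, q) \<in> graph_polys G"
  shows "\<exists>s s' r r'. (s, s') \<in> graph_polys G \<and> (r, r') \<in> graph_polys G \<and>
           p = s * m + r \<and> q = s' * m' + r' \<and> (r = 0 \<or> degree r < degree m)"
proof -
  \<comment> \<open>induction on a strict bound for the indices of nonzero coefficients of the dividend\<close>
  have "\<exists>s s' r r'. (s, s') \<in> graph_polys G \<and> (r, r') \<in> graph_polys G \<and>
           p = s * m + r \<and> q = s' * m' + r' \<and> (r = 0 \<or> degree r < degree m)"
    if "\<forall>i\<ge>n. coeff p i = 0" "(p, q) \<in> graph_polys G" for n p q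
    using that
  proof (induction n arbitrary: p q)
    case 0
    then have "p = 0"
      by (intro poly_eqI) simp
    moreover have "q = 0"
      using 0 \<open>p = 0\<close> graph_polys_0D by simp
    ultimately have "p = 0 * m + 0" "q = 0 * m' + 0"
      by simp_all
    then show ?case
      using graph_polys_0 by blast
  next
    case (Suc n)
    show ?case
    proof (cases "n < degree m")
      case True
      have "degree p \<le> n"
        using Suc.prems(1) by (intro degree_le) auto
      then have "degree p < degree m" "p = 0 * m + p" "q = 0 * m' + q"
        using True by simp_all
      then show ?thesis
        using Suc.prems(2) graph_polys_0 by blast
    next
      case False
      define d where "d = degree m"
      have "n \<ge> d"
        using False by (simp add: d_def)
      define c where "c = coeff p n * inverse (coeff m d)"
      define c' where "c' = coeff q n * inverse (coeff m' d)"
      have md: "coeff m d \<noteq> 0"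
        using m(2) by (simp add: d_def)
      have c: "(monom c (n - d), monom c' (n - d)) \<in> graph_polys G"
        unfolding c_def c'_def
        using graph_polysD[OF Suc.prems(2), of n] graph_polysD[OF m(1), of d] md
        by (intro graph_polys_monom graph_mult graph_inverse)
      have cm: "(p - monom c (n - d) * m, q - monom c' (n - d) * m') \<in> graph_polys G"
        by (intro graph_polys_diff graph_polys_mult Suc.prems(2) c m(1))
      have "coeff (p - monom c (n - d) * m) i = 0" if "i \<ge> n" for i
      proof (cases "i = n")
        case True
        then show ?thesis
          using \<open>n \<ge> d\<close> md by (simp add: coeff_monom_mult c_def)
      next
        case False
        then have "coeff p i = 0" "coeff m (i - (n - d)) = 0"
          using Suc.prems(1) that \<open>n \<ge> d\<close> unfolding d_def by (simp, intro coeff_eq_0, simp)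
        then show ?thesis
          by (simp add: coeff_monom_mult)
      qed
      then obtain s s' r r' where srs: "(s, s') \<in> graph_polys G" "(r, r') \<in> graph_polys G"
        "p - monom c (n - d) * m = s * m + r" "q - monom c' (n - d) * m' = s' * m' + r'"
        "r = 0 \<or> degree r < degree m"
        using Suc.IH[OF _ cm] by blast
      then have "p = (monom c (n - d) + s) * m + r" "q = (monom c' (n - d) + s') * m' + r'"
        by (simp_all add: algebra_simps)
      then show ?thesis
        using srs c graph_polys_add by blast
    qed
  qed
  from this[of "Suc (degree p)" p q] show ?thesis
    using assms(3) by (auto simp: coeff_eq_0)
qed

text \<open>The minimal polynomial \<open>m\<close> of \<open>x\<close> over the domain, with its image \<open>m'\<close>. Both divide the image of one
  polynomial over the base field, which the partial map leaves unchanged; this makes \<open>m'\<close> separable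
  as well.\<close>

lemma minimal_graph_poly:
  fixes x :: 'k
  shows "\<exists>m m'. (m, m') \<in> graph_polys G \<and> m \<noteq> 0 \<and> poly m x = 0 \<and>
    separable_poly m \<and> separable_poly m' \<and> degree m' > 0 \<and>
    (\<forall>p q. (p, q) \<in> graph_polys G \<longrightarrow> poly p x = 0 \<longrightarrow> (\<exists>s s'. p = s * m \<and> q = s' * m'))"
proof -
  obtain p0 where p0: "irreducible p0" "separable_poly p0" "poly (map_poly \<iota> p0) x = 0"
    using alg[of x] by (auto simp: separable_element_def)
  define P where "P = map_poly \<iota> p0"
  have P: "(P, P) \<in> graph_polys G"
    unfolding P_def by (rule graph_polys_base)
  have "P \<noteq> 0"
  proof
    assume "P = 0"
    then have "\<iota> (coeff p0 n) = 0" for n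
      using coeff_map_poly[of \<iota> p0 n] by (simp add: P_def field_embedding_0[OF emb])
    then have "p0 = 0"
      by (intro poly_eqI) (simp add: field_embedding_eq_0_iff[OF emb])
    with p0(1) show False
      by simp
  qed
  have sepP: "separable_poly P"
    unfolding P_def by (rule separable_poly_map_poly[OF emb p0(2)])
  define ann where "ann = (\<lambda>(p, q). (p, q) \<in> graph_polys G \<and> p \<noteq> 0 \<and> poly p x = 0)"
  have "ann (P, P)"
    using P \<open>P \<noteq> 0\<close> p0(3) by (simp add: ann_def P_def)
  then have "\<exists>mm. ann mm \<and> (\<forall>pq. ann pq \<longrightarrow> degree (fst mm) \<le> degree (fst pq))"
    by (rule ex_has_least_nat)
  then obtain mm where mm: "ann mm" "\<And>pq. ann pq \<Longrightarrow> degree (fst mm) \<le> degree (fst pq)"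
    by blast
  obtain m m' where "mm = (m, m')"
    by (cases mm)
  with mm have m: "ann (m, m')" and least: "\<And>p q. ann (p, q) \<Longrightarrow> degree m \<le> degree p"
    by auto
  have m_props: "(m, m') \<in> graph_polys G" "m \<noteq> 0" "poly m x = 0"
    using m by (auto simp: ann_def)
  have div: "\<exists>s s'. p = s * m \<and> q = s' * m'" if pq: "(p, q) \<in> graph_polys G" "poly p x = 0" for p q
  proof -
    obtain s s' r r' where sr: "(r, r') \<in> graph_polys G" "p = s * m + r" "q = s' * m' + r'"
      "r = 0 \<or> degree r < degree m"
      using graph_polys_division[OF m_props(1,2) pq(1)] by blast
    have "poly r x = 0"
      using pq(2) m_props(3) by (simp add: sr(2))
    then have "r = 0"
      using sr(1,4) least[of r r'] by (cases "r = 0") (auto simp: ann_def)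
    moreover have "r' = 0"
      using sr(1) \<open>r = 0\<close> graph_polys_0D by blast
    ultimately show ?thesis
      using sr(2,3) by auto
  qed
  have "poly P x = 0"
    using p0(3) by (simp add: P_def)
  from div[OF P this] obtain s s' where "P = s * m" "P = s' * m'"
    by blast
  then have "m dvd P" "m' dvd P"
    by (metis dvd_triv_right)+
  then have "separable_poly m" "separable_poly m'"
    using sepP separable_poly_dvd by blast+
  moreover have "degree m > 0"
  proof (rule ccontr)
    assume "\<not> degree m > 0"
    then obtain c where "m = [:c:]"
      by (auto elim: degree_eq_zeroE)
    with m_props show False
      by simp
  qed
  then have "degree m' > 0"
    using graph_polys_degree[OF m_props(1)] by simp
  ultimately show ?thesis
    using m_props div by blast
qed

text \<open>The partial map extended to the subring generated by \<open>x\<close>, with \<open>x\<close> sent to \<open>y\<close>.\<close>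

definition graph_adjoin :: "'k \<Rightarrow> 'k \<Rightarrow> ('k \<times> 'k) set" where
  "graph_adjoin x y = {(poly p x, poly q y) | p q. (p, q) \<in> graph_polys G}"

text \<open>A polynomial that vanishes at \<open>x\<close> is a multiple of \<open>m\<close>, so its image vanishes at the root \<open>y\<close>
  of \<open>m'\<close>. Hence the value at \<open>y\<close> depends only on the value at \<open>x\<close>.\<close>

lemma partial_embedding_adjoin:
  assumes m: "(m, m') \<in> graph_polys G"
    and div: "\<And>p q. (p, q) \<in> graph_polys G \<Longrightarrow> poly p x = 0 \<Longrightarrow> \<exists>s s'. p = s * m \<and> q = s' * m'"
    and root: "poly m' y = 0"
  shows "partial_embedding \<iota> (graph_adjoin x y)" "G \<subseteq> graph_adjoin x y" "(x, y) \<in> graph_adjoin x y"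
proof -
  show sub: "G \<subseteq> graph_adjoin x y"
  proof clarify
    fix u v
    assume "(u, v) \<in> G"
    then have "([:u:], [:v:]) \<in> graph_polys G"
      by (rule graph_polys_const)
    then show "(u, v) \<in> graph_adjoin x y"
      unfolding graph_adjoin_def by force
  qed
  show "(x, y) \<in> graph_adjoin x y"
    unfolding graph_adjoin_def using graph_polys_X by force
  show "partial_embedding \<iota> (graph_adjoin x y)"
    unfolding partial_embedding_def
  proof (intro conjI allI impI)
    fix c
    show "(\<iota> c, \<iota> c) \<in> graph_adjoin x y"
      using sub graph_base by blast
  next
    fix u v u' v'
    assume "(u, v) \<in> graph_adjoin x y" "(u', v') \<in> graph_adjoin x y"
    then obtain p q p' q' where pq: "(p, q) \<in> graph_polys G" "(p', q') \<in> graph_polys G"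
      "u = poly p x" "v = poly q y" "u' = poly p' x" "v' = poly q' y"
      unfolding graph_adjoin_def by blast
    have "u + u' = poly (p + p') x" "v + v' = poly (q + q') y"
      by (simp_all add: pq)
    then show "(u + u', v + v') \<in> graph_adjoin x y"
      unfolding graph_adjoin_def using graph_polys_add[OF pq(1,2)] by blast
    have "u * u' = poly (p * p') x" "v * v' = poly (q * q') y"
      by (simp_all add: pq)
    then show "(u * u', v * v') \<in> graph_adjoin x y"
      unfolding graph_adjoin_def using graph_polys_mult[OF pq(1,2)] by blast
  next
    fix v
    assume "(0, v) \<in> graph_adjoin x y"
    then obtain p q where pq: "(p, q) \<in> graph_polys G" "poly p x = 0" "v = poly q y"
      unfolding graph_adjoin_def by auto
    then obtain s' where "q = s' * m'"
      using div by blast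
    then show "v = 0"
      using root pq(3) by simp
  qed
qed

end
end

lemma separable_closureD:
  fixes \<iota> :: "'a::field \<Rightarrow> 'k::field" and p :: "'k poly"
  assumes "separable_closure \<iota>"
  shows "field_embedding \<iota>" "separable_element \<iota> x"
    "degree p > 0 \<Longrightarrow> separable_poly p \<Longrightarrow> \<exists>x. poly p x = 0"
  using assms unfolding separable_closure_def by blast+

text \<open>A maximal partial embedding is defined everywhere, since the image of the minimal polynomial of
  any \<open>x\<close> is separable and so has a root to which \<open>x\<close> can be sent. The resulting endomorphism is onto
  because it permutes the finitely many roots of each polynomial over the base field.\<close>

lemma partial_embedding_extends:
  assumes cl: "separable_closure \<iota>" and G: "partial_embedding \<iota> G"
  shows "\<exists>\<sigma>\<in>galois_group \<iota>. \<forall>(x, y)\<in>G. \<sigma> x = y"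
proof -
  note emb = separable_closureD(1)[OF cl] and alg = separable_closureD(2)[OF cl]
  define \<A> where "\<A> = {H. partial_embedding \<iota> H \<and> G \<subseteq> H}"
  have "\<exists>M\<in>\<A>. \<forall>H\<in>\<A>. M \<subseteq> H \<longrightarrow> H = M"
  proof (rule subset_Zorn_nonempty)
    show "\<A> \<noteq> {}"
      using G by (auto simp: \<A>_def)
  next
    fix \<C>
    assume ne: "\<C> \<noteq> {}" and chain: "subset.chain \<A> \<C>"
    then have C: "\<And>H. H \<in> \<C> \<Longrightarrow> partial_embedding \<iota> H \<and> G \<subseteq> H"
      unfolding subset_chain_def \<A>_def by blast
    have "partial_embedding \<iota> (\<Union>\<C>)"
      unfolding partial_embedding_def
    proof (intro conjI allI impI)
      fix c
      show "(\<iota> c, \<iota> c) \<in> \<Union>\<C>"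
        using ne C unfolding partial_embedding_def by blast
    next
      fix u v u' v'
      assume "(u, v) \<in> \<Union>\<C>" "(u', v') \<in> \<Union>\<C>"
      then obtain H H' where HH: "H \<in> \<C>" "H' \<in> \<C>" "(u, v) \<in> H" "(u', v') \<in> H'"
        by blast
      moreover have "H \<subseteq> H' \<or> H' \<subseteq> H"
        using chain HH(1,2) unfolding subset_chain_def by blast
      ultimately obtain K where K: "K \<in> \<C>" "(u, v) \<in> K" "(u', v') \<in> K"
        by blast
      then have "partial_embedding \<iota> K"
        using C by blast
      from graph_add[OF emb this K(2,3)] graph_mult[OF emb this K(2,3)] K(1)
      show "(u + u', v + v') \<in> \<Union>\<C>" "(u * u', v * v') \<in> \<Union>\<C>"
        by blast+
    next
      fix v
      assume "(0, v) \<in> \<Union>\<C>"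
      then show "v = 0"
        using C unfolding partial_embedding_def by blast
    qed
    then show "\<Union>\<C> \<in> \<A>"
      using ne C unfolding \<A>_def by blast
  qed
  then obtain M where "M \<in> \<A>" and max: "\<And>H. H \<in> \<A> \<Longrightarrow> M \<subseteq> H \<Longrightarrow> H = M"
    by blast
  then have M: "partial_embedding \<iota> M" and GM: "G \<subseteq> M"
    unfolding \<A>_def by blast+
  have total: "\<exists>y. (x, y) \<in> M" for x
  proof -
    obtain m m' where m: "(m, m') \<in> graph_polys M" "separable_poly m'" "degree m' > 0"
      "\<And>p q. (p, q) \<in> graph_polys M \<Longrightarrow> poly p x = 0 \<Longrightarrow> \<exists>s s'. p = s * m \<and> q = s' * m'"
      using minimal_graph_poly[OF emb M alg, of x] by blast
    then obtain y where "poly m' y = 0"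
      using separable_closureD(3)[OF cl] by blast
    note ext = partial_embedding_adjoin[where x = x, OF emb M alg m(1) m(4) this]
    have "graph_adjoin M x y = M"
      using ext(1,2) GM by (intro max) (auto simp: \<A>_def)
    then show ?thesis
      using ext(3) by blast
  qed
  define \<sigma> where "\<sigma> x = (THE y. (x, y) \<in> M)" for x
  have \<sigma>: "(x, y) \<in> M \<longleftrightarrow> \<sigma> x = y" for x y
  proof -
    have "\<exists>!y. (x, y) \<in> M"
      using total graph_unique[OF emb M] by blast
    then show ?thesis
      unfolding \<sigma>_def by (metis theI')
  qed
  have hom: "field_embedding \<sigma>"
    unfolding field_embedding_def
    using graph_1[OF emb M] graph_add[OF emb M] graph_mult[OF emb M] \<sigma> by blast
  have fix_base: "\<sigma> (\<iota> c) = \<iota> c" for c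
    using graph_base[OF emb M, of c] \<sigma> by blast
  have inj: "inj \<sigma>"
    by (rule injI) (simp add: field_embedding_eq_iff[OF hom])
  have "surj \<sigma>"
    unfolding surj_def
  proof
    fix z
    obtain p where p: "irreducible p" "separable_poly p" "poly (map_poly \<iota> p) z = 0"
      using alg[of z] by (auto simp: separable_element_def)
    define R where "R = {x. poly (map_poly \<iota> p) x = 0}"
    have "map_poly \<iota> p \<noteq> 0"
    proof
      assume "map_poly \<iota> p = 0"
      moreover have "separable_poly (map_poly \<iota> p)"
        by (rule separable_poly_map_poly[OF emb p(2)])
      ultimately show False
        by (simp add: separable_poly_def)
    qed
    then have "finite R"
      unfolding R_def by (rule poly_roots_finite)
    have \<sigma>_poly: "\<sigma> (poly (map_poly \<iota> q) x) = poly (map_poly \<iota> q) (\<sigma> x)" for q x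
      by (induction q)
         (simp_all add: map_poly_pCons field_embedding_0[OF emb] field_embedding_simps[OF hom] fix_base)
    have "\<sigma> ` R \<subseteq> R"
      unfolding R_def by (auto simp: \<sigma>_poly[symmetric] field_embedding_0[OF hom])
    then have "\<sigma> ` R = R"
      using \<open>finite R\<close> inj by (intro endo_inj_surj) (auto intro: inj_on_subset)
    then show "\<exists>x. z = \<sigma> x"
      using p(3) unfolding R_def by blast
  qed
  then have "\<sigma> \<in> galois_group \<iota>"
    using hom inj fix_base by (simp add: galois_group_def bij_def)
  moreover have "\<forall>(x, y)\<in>G. \<sigma> x = y"
    using GM \<sigma> by blast
  ultimately show ?thesis
    by blast
qed

text \<open>Split the linear factor at \<open>x\<close> off its minimal polynomial. If the cofactor \<open>h\<close> is not constant, then it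
  has a root, which differs from \<open>x\<close> by separability, and some automorphism moves \<open>x\<close> to that root.\<close>

lemma galois_group_fixed_field:
  assumes cl: "separable_closure \<iota>" and fixed: "\<And>\<sigma>. \<sigma> \<in> galois_group \<iota> \<Longrightarrow> \<sigma> x = x"
  shows "x \<in> range \<iota>"
proof -
  note emb = separable_closureD(1)[OF cl] and alg = separable_closureD(2)[OF cl]
  define G where "G = {(\<iota> c, \<iota> c) | c. True}"
  have G: "partial_embedding \<iota> G"
    unfolding partial_embedding_def
  proof (intro conjI allI impI)
    fix u v u' v'
    assume "(u, v) \<in> G" "(u', v') \<in> G"
    then obtain c c' where c: "u = \<iota> c" "v = \<iota> c" "u' = \<iota> c'" "v' = \<iota> c'"
      by (auto simp: G_def)
    have "(\<iota> (c + c'), \<iota> (c + c')) \<in> G" "(\<iota> (c * c'), \<iota> (c * c')) \<in> G"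
      by (auto simp: G_def)
    then show "(u + u', v + v') \<in> G" "(u * u', v * v') \<in> G"
      by (simp_all add: c field_embedding_simps[OF emb])
  qed (auto simp: G_def)
  obtain m m' where m: "(m, m') \<in> graph_polys G" "m \<noteq> 0" "poly m x = 0" "separable_poly m"
      "\<And>p q. (p, q) \<in> graph_polys G \<Longrightarrow> poly p x = 0 \<Longrightarrow> \<exists>s s'. p = s * m \<and> q = s' * m'"
    using minimal_graph_poly[OF emb G alg, of x] by blast
  have coeff_m: "coeff m n \<in> range \<iota>" "coeff m' n = coeff m n" for n
    using graph_polysD[OF m(1), of n] by (auto simp: G_def)
  have "m' = m"
    by (intro poly_eqI coeff_m)
  obtain h where h: "m = [:- x, 1:] * h"
    using m(3) unfolding poly_eq_0_iff_dvd by (rule dvdE)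
  have "h \<noteq> 0"
    using h m(2) by auto
  then have deg: "degree m = Suc (degree h)"
    unfolding h by (subst degree_mult_eq) auto
  have "degree h = 0"
  proof (rule ccontr)
    assume "degree h \<noteq> 0"
    moreover have "separable_poly h"
      by (rule separable_poly_dvd[OF m(4)]) (unfold h, rule dvd_triv_right)
    ultimately obtain y where y: "poly h y = 0"
      using separable_closureD(3)[OF cl] by blast
    have "poly (pderiv m) x = poly h x"
      unfolding h pderiv_mult by (simp add: pderiv_pCons)
    then have "y \<noteq> x"
      using separable_poly_simple_root[OF m(4,3)] y by auto
    have "poly m' y = 0"
      using y \<open>m' = m\<close> h by simp
    note ext = partial_embedding_adjoin[where x = x, OF emb G alg m(1) m(5) this]
    obtain \<sigma> where "\<sigma> \<in> galois_group \<iota>" "\<forall>(x, y)\<in>graph_adjoin G x y. \<sigma> x = y"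
      using partial_embedding_extends[OF cl ext(1)] by blast
    then have "\<sigma> \<in> galois_group \<iota>" "\<sigma> x = y"
      using ext(3) by auto
    with fixed \<open>y \<noteq> x\<close> show False
      by blast
  qed
  then obtain d where d: "h = [:d:]"
    by (auto elim: degree_eq_zeroE)
  have "m = [:- (x * d), d:]"
    by (simp add: h d)
  then have "- (x * d) \<in> range \<iota>" "d \<in> range \<iota>"
    using coeff_m(1)[of 0] coeff_m(1)[of 1] by auto
  then obtain c0 c1 where c: "- (x * d) = \<iota> c0" "d = \<iota> c1"
    by blast
  have "d \<noteq> 0"
    using d \<open>h \<noteq> 0\<close> by auto
  then have "c1 \<noteq> 0"
    using c(2) by (simp add: field_embedding_eq_0_iff[OF emb])
  have "\<iota> (- c0 * inverse c1) * d = x * d"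
  proof -
    have "\<iota> (- c0 * inverse c1) * d = \<iota> (- c0 * inverse c1 * c1)"
      by (simp only: c(2) field_embedding_mult[OF emb])
    also have "\<dots> = - \<iota> c0"
      using \<open>c1 \<noteq> 0\<close> by (simp add: mult.assoc field_embedding_minus[OF emb])
    finally show ?thesis
      by (simp flip: c(1))
  qed
  then have "x = \<iota> (- c0 * inverse c1)"
    using \<open>d \<noteq> 0\<close> by simp
  then show ?thesis
    by blast
qed

section \<open>Roots of cubics without quadratic term\<close>

definition cubic_roots :: "'k::field \<Rightarrow> 'k \<Rightarrow> 'k set" where
  "cubic_roots a b = {x. x^3 + a * x + b = 0}"

lemma cubic_roots_of_coefficients:
  "cubic_roots (- (x^2 + x * y + y^2)) (x * y * (x + y)) = {x, y, - x - y}"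
proof -
  have "t^3 + - (x^2 + x * y + y^2) * t + x * y * (x + y) = (t - x) * (t - y) * (t - (- x - y))" for t
    by (simp add: algebra_simps power2_eq_square power3_eq_cube)
  then show ?thesis
    by (auto simp: cubic_roots_def)
qed

text \<open>Two distinct roots determine the cubic, because the third root is minus their sum.\<close>

lemma coefficients_of_cubic_roots:
  assumes "x \<in> cubic_roots a b" "y \<in> cubic_roots a b" "x \<noteq> y"
  shows "a = - (x^2 + x * y + y^2)" "b = x * y * (x + y)"
proof -
  have "(x - y) * (x^2 + x * y + y^2 + a) = (x^3 + a * x + b) - (y^3 + a * y + b)"
    by (simp add: algebra_simps power2_eq_square power3_eq_cube)
  also have "\<dots> = 0"
    using assms by (simp add: cubic_roots_def)
  finally have "(x^2 + x * y + y^2) + a = 0"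
    using assms(3) by simp
  then show a: "a = - (x^2 + x * y + y^2)"
    by (simp only: add_eq_0_iff)
  have "(- (x^3 + a * x)) + (x^3 + a * x + b) = 0 - (x^3 + a * x)"
    using assms(1) by (simp add: cubic_roots_def)
  then have "b = - (x^3 + a * x)"
    by simp
  then show "b = x * y * (x + y)"
    unfolding a by (simp add: algebra_simps power2_eq_square power3_eq_cube)
qed

lemma cubic_discriminant:
  fixes x y :: "'k::field"
  assumes "a = - (x^2 + x * y + y^2)" "b = x * y * (x + y)"
  shows "4 * a^3 + 27 * b^2 = - (((x - y) * (x - (- x - y)) * (y - (- x - y)))^2)"
  unfolding assms by (simp add: algebra_simps eval_nat_numeral)

text \<open>The discriminant is a polynomial combination of the cubic and its derivative.\<close>

lemma separable_cubic:
  fixes a b :: "'k::field"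
  assumes "4 * a^3 + 27 * b^2 \<noteq> 0"
  shows "separable_poly [:b, a, 0, 1:]"
proof -
  define D where "D = 4 * a^3 + 27 * b^2"
  have "[:27 * b, - 18 * a:] * [:b, a, 0, 1:] + [:4 * a^2, - 9 * b, 6 * a:] * pderiv [:b, a, 0, 1:] = [:D:]"
    by (simp add: D_def pderiv_pCons algebra_simps power2_eq_square power3_eq_cube)
  then have "smult (inverse D) [:27 * b, - 18 * a:] * [:b, a, 0, 1:] +
      smult (inverse D) [:4 * a^2, - 9 * b, 6 * a:] * pderiv [:b, a, 0, 1:] = smult (inverse D) [:D:]"
    by (metis mult_smult_left smult_add_right)
  also have "\<dots> = 1"
    using assms by (simp add: D_def)
  finally show ?thesis
    unfolding separable_poly_bezout by blast
qed

lemma separably_closed_cubic_roots: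
  assumes cl: "separable_closure (\<iota> :: 'a::field \<Rightarrow> 'k::field)"
    and D: "4 * a^3 + 27 * b^2 \<noteq> (0::'k)"
  shows "\<exists>x y. a = - (x^2 + x * y + y^2) \<and> b = x * y * (x + y) \<and>
           x \<noteq> y \<and> x \<noteq> - x - y \<and> y \<noteq> - x - y"
proof -
  note sep = separable_cubic[OF D]
  then obtain x where x: "poly [:b, a, 0, 1:] x = 0"
    using separable_closureD(3)[OF cl, of "[:b, a, 0, 1:]"] by auto
  then have b: "b = - (x^3 + a * x)"
    by (simp add: algebra_simps power3_eq_cube add_eq_0_iff)
  have fac: "[:b, a, 0, 1:] = [:x^2 + a, x, 1:] * [:- x, 1:]"
    unfolding b by (simp add: algebra_simps power2_eq_square power3_eq_cube)
  have "separable_poly [:x^2 + a, x, 1:]"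
    by (rule separable_poly_dvd[OF sep]) (unfold fac, rule dvd_triv_left)
  then obtain y where "poly [:x^2 + a, x, 1:] y = 0"
    using separable_closureD(3)[OF cl, of "[:x^2 + a, x, 1:]"] by auto
  then have "(x^2 + x * y + y^2) + a = 0"
    by (simp add: algebra_simps power2_eq_square)
  then have a: "a = - (x^2 + x * y + y^2)"
    by (simp only: add_eq_0_iff)
  have b': "b = x * y * (x + y)"
    unfolding b a by (simp add: algebra_simps power2_eq_square power3_eq_cube)
  show ?thesis
    using D unfolding cubic_discriminant[OF a b'] using a b' by (intro exI[of _ x] exI[of _ y]) auto
qed

text \<open>The Tschirnhaus transformation that takes the roots of \<open>x\<^sup>3 + a x + b\<close> to the roots of the cubic of
  \<open>\<E>\<^bsub>u,v\<^esub>\<close>. The constant term \<open>2 a u\<close> makes the three new roots sum to zero, as the squares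
  of the old ones sum to \<open>- 2 a\<close>.\<close>

definition tschirnhaus :: "'k::field \<Rightarrow> 'k \<Rightarrow> 'k \<Rightarrow> 'k \<Rightarrow> 'k" where
  "tschirnhaus a u v x = 3 * v * x + 3 * u * x^2 + 2 * a * u"

lemma tschirnhaus_sum:
  assumes "a = - (x^2 + x * y + y^2)"
  shows "tschirnhaus a u v (- x - y) = - tschirnhaus a u v x - tschirnhaus a u v y"
  unfolding tschirnhaus_def assms by (simp add: algebra_simps power2_eq_square)

text \<open>If \<open>x\<close> and \<open>y\<close> are two of the roots, then \<open>- x - y\<close> is the third one. This factorisation explains
  both injectivity and the factor in the discriminant formula.\<close>

lemma tschirnhaus_diff:
  "tschirnhaus a u v x - tschirnhaus a u v y = 3 * (x - y) * (v - u * (- x - y))"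
  unfolding tschirnhaus_def by (simp add: algebra_simps power2_eq_square)

text \<open>The defining coefficients of the family are the elementary symmetric functions of the transformed
  roots, up to sign. With \<open>a\<close> and \<open>b\<close> written in terms of two roots, this is an identity of polynomials
  in free variables.\<close>

lemma mod2_family_coefficients:
  fixes a b u v x y :: "'k::field"
  assumes "a = - (x^2 + x * y + y^2)" "b = x * y * (x + y)"
  defines "w \<equiv> tschirnhaus a u v"
  shows "3 * (3 * a * v^2 + 9 * b * u * v - a^2 * u^2) = - ((w x)^2 + w x * w y + (w y)^2)"
    and "27 * b * v^3 - 18 * a^2 * u * v^2 - 27 * a * b * u^2 * v - (2 * a^3 + 27 * b^2) * u^3
           = w x * w y * (w x + w y)"
  unfolding w_def tschirnhaus_def assms by (simp_all add: algebra_simps eval_nat_numeral)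

lemma mod2_family_cubic_discriminant:
  fixes a b u v :: "'k::field"
  shows "4 * (3 * (3 * a * v^2 + 9 * b * u * v - a^2 * u^2))^3 +
     27 * (27 * b * v^3 - 18 * a^2 * u * v^2 - 27 * a * b * u^2 * v - (2 * a^3 + 27 * b^2) * u^3)^2 =
     3^6 * (v^3 + a * u^2 * v + b * u^3)^2 * (4 * a^3 + 27 * b^2)"
  by (simp add: algebra_simps eval_nat_numeral)

text \<open>A cubic with zero discriminant has the double root \<open>- 3 b / (2 a)\<close>, or \<open>0\<close> if \<open>a = 0\<close>. It lies in the
  base field and gives a singular point on the x-axis.\<close>

lemma nonsingular_short_weierstrass:
  fixes a b :: "'a::field"
  assumes two: "(2::'a) \<noteq> 0" and three: "(3::'a) \<noteq> 0"
    and ns: "nonsingular (short_weierstrass a b)"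
  shows "4 * a^3 + 27 * b^2 \<noteq> 0"
proof
  assume D: "4 * a^3 + 27 * b^2 = 0"
  have "\<exists>x. x^3 + a * x + b = 0 \<and> 3 * x^2 + a = 0"
  proof (cases "a = 0")
    case True
    have "(27::'a) = 3^3"
      by simp
    then have "(27::'a) \<noteq> 0"
      using three by (simp only: power_eq_0_iff) simp
    then have "b = 0"
      using D True by simp
    with True show ?thesis
      by (intro exI[of _ 0]) simp
  next
    case False
    define x where "x = - (3 * b) / (2 * a)"
    have x: "2 * a * x = - (3 * b)"
      using two False by (simp add: x_def)
    have "4 * a^2 * (3 * x^2 + a) = 3 * (2 * a * x)^2 + 4 * a^3"
      by (simp add: algebra_simps eval_nat_numeral)
    also have "\<dots> = 0"
      unfolding x using D by (simp add: algebra_simps power2_eq_square)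
    finally have d: "3 * x^2 + a = 0"
      using two False power_eq_0_iff[of "2::'a" 2] by auto
    have "3 * (x^3 + a * x + b) = x * (3 * x^2 + a) + 2 * a * x + 3 * b"
      by (simp add: algebra_simps eval_nat_numeral)
    also have "\<dots> = 0"
      unfolding d x by simp
    finally have "x^3 + a * x + b = 0"
      using three mult_eq_0_iff by blast
    with d show ?thesis
      by blast
  qed
  then obtain x where x: "x^3 + a * x + b = 0" "3 * x^2 + a = 0"
    by blast
  have "to_ac (x^3 + a * x + b) = 0" "to_ac (3 * x^2 + a) = 0"
    unfolding x by simp_all
  then have "singular_point (map_weierstrass to_ac (short_weierstrass a b)) (to_ac x) 0"
    unfolding singular_point_def on_curve_def short_weierstrass_def by simp
  with ns show False
    unfolding nonsingular_def by blast
qed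

section \<open>Two-torsion points\<close>

lemma point_add_self_eq_Infinity_iff:
  "point_add W (Affine x y) (Affine x y) = Infinity \<longleftrightarrow> 2 * y + wa1 W * x + wa3 W = 0"
proof -
  have "y - (- y - wa1 W * x - wa3 W) = 2 * y + wa1 W * x + wa3 W"
    by (simp add: algebra_simps)
  then have "y = - y - wa1 W * x - wa3 W \<longleftrightarrow> 2 * y + wa1 W * x + wa3 W = 0"
    by (metis eq_iff_diff_eq_0)
  then show ?thesis
    by (simp only: point_add.simps Let_def) simp
qed

lemma two_torsion_eq:
  "two_torsion \<iota> W = insert Infinity {Affine x y | x y.
     on_curve (map_weierstrass \<iota> W) x y \<and>
     2 * y + wa1 (map_weierstrass \<iota> W) * x + wa3 (map_weierstrass \<iota> W) = 0}"
  unfolding two_torsion_def curve_points_def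
  by (auto simp: point_add_self_eq_Infinity_iff simp del: point_add.simps(3))

lemma two_torsion_short_weierstrass:
  fixes \<iota> :: "'a::field \<Rightarrow> 'k::field"
  assumes emb: "field_embedding \<iota>" and two: "(2::'k) \<noteq> 0"
  shows "two_torsion \<iota> (short_weierstrass a b) =
    insert Infinity ((\<lambda>x. Affine x 0) ` cubic_roots (\<iota> a) (\<iota> b))"
  unfolding two_torsion_eq using two
  by (auto simp: short_weierstrass_def on_curve_def cubic_roots_def field_embedding_0[OF emb])

lemma point_add_two_torsion:
  assumes "wa1 W = 0" "wa2 W = 0" "wa3 W = 0"
  shows "point_add W (Affine x 0) (Affine x' 0) =
    (if x = x' then Infinity else Affine (- x - x') 0)"
  using assms by (simp add: Let_def)

lemma galois_cubic_roots:
  fixes \<iota> :: "'a::field \<Rightarrow> 'k::field"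
  assumes "\<sigma> \<in> galois_group \<iota>" "x \<in> cubic_roots (\<iota> a) (\<iota> b)"
  shows "\<sigma> x \<in> cubic_roots (\<iota> a) (\<iota> b)"
proof -
  have hom: "field_embedding \<sigma>" and fix_base: "\<And>c. \<sigma> (\<iota> c) = \<iota> c"
    using assms(1) by (auto simp: galois_group_def)
  have "(\<sigma> x)^3 + \<iota> a * \<sigma> x + \<iota> b = \<sigma> (x^3 + \<iota> a * x + \<iota> b)"
    by (simp add: field_embedding_simps[OF hom] fix_base)
  also have "\<dots> = 0"
    using assms(2) by (simp add: cubic_roots_def field_embedding_0[OF hom])
  finally show ?thesis
    by (simp add: cubic_roots_def)
qed

text \<open>A bijection between the roots of two cubics extends to the 2-torsion by fixing the point at
  infinity. Additivity reduces to the sum of two distinct points \<open>(x, 0)\<close> and \<open>(y, 0)\<close>, which is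
  \<open>(- x - y, 0)\<close>.\<close>

lemma two_torsion_iso_of_roots:
  fixes \<iota> :: "'a::field \<Rightarrow> 'k::field"
  assumes emb: "field_embedding \<iota>" and two: "(2::'k) \<noteq> 0"
    and bij: "bij_betw h (cubic_roots (\<iota> a) (\<iota> b)) (cubic_roots (\<iota> a') (\<iota> b'))"
    and add: "\<And>x y. x \<in> cubic_roots (\<iota> a) (\<iota> b) \<Longrightarrow> y \<in> cubic_roots (\<iota> a) (\<iota> b) \<Longrightarrow> x \<noteq> y \<Longrightarrow>
                h (- x - y) = - h x - h y"
    and equiv: "\<And>\<sigma> x. \<sigma> \<in> galois_group \<iota> \<Longrightarrow> x \<in> cubic_roots (\<iota> a) (\<iota> b) \<Longrightarrow> h (\<sigma> x) = \<sigma> (h x)"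
  shows "two_torsion_iso \<iota> (short_weierstrass a b) (short_weierstrass a' b')"
proof -
  define R where "R = cubic_roots (\<iota> a) (\<iota> b)"
  define R' where "R' = cubic_roots (\<iota> a') (\<iota> b')"
  define \<phi> where "\<phi> P = (case P of Infinity \<Rightarrow> Infinity | Affine x y \<Rightarrow> Affine (h x) 0)" for P
  have \<phi>_simps: "\<phi> Infinity = Infinity" "\<phi> (Affine x y) = Affine (h x) 0" for x y
    by (simp_all add: \<phi>_def)
  note T = two_torsion_short_weierstrass[OF emb two, of a b, folded R_def]
    two_torsion_short_weierstrass[OF emb two, of a' b', folded R'_def]
  have coeffs: "wa1 (map_weierstrass \<iota> (short_weierstrass c d)) = 0"
    "wa2 (map_weierstrass \<iota> (short_weierstrass c d)) = 0"
    "wa3 (map_weierstrass \<iota> (short_weierstrass c d)) = 0" for c d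
    by (simp_all add: short_weierstrass_def field_embedding_0[OF emb])
  note padd = point_add_two_torsion[OF coeffs]
  have inj: "inj_on h R" and im: "h ` R = R'"
    using bij by (auto simp: bij_betw_def R_def R'_def)
  have bij\<phi>: "bij_betw \<phi> (insert Infinity ((\<lambda>x. Affine x 0) ` R)) (insert Infinity ((\<lambda>x. Affine x 0) ` R'))"
    unfolding bij_betw_def
  proof
    show "inj_on \<phi> (insert Infinity ((\<lambda>x. Affine x 0) ` R))"
      using inj by (auto simp: inj_on_def \<phi>_simps)
    show "\<phi> ` (insert Infinity ((\<lambda>x. Affine x 0) ` R)) = insert Infinity ((\<lambda>x. Affine x 0) ` R')"
      by (simp add: image_image \<phi>_simps flip: im)
  qed
  have hom: "\<phi> (point_add (map_weierstrass \<iota> (short_weierstrass a b)) P Q) =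
      point_add (map_weierstrass \<iota> (short_weierstrass a' b')) (\<phi> P) (\<phi> Q)"
    if PQ: "P \<in> insert Infinity ((\<lambda>x. Affine x 0) ` R)" "Q \<in> insert Infinity ((\<lambda>x. Affine x 0) ` R)" for P Q
  proof (cases "P = Infinity \<or> Q = Infinity")
    case True
    then show ?thesis
      using PQ by (auto simp: \<phi>_simps)
  next
    case False
    then obtain x y where P: "P = Affine x 0" "x \<in> R" and Q: "Q = Affine y 0" "y \<in> R"
      using PQ by blast
    show ?thesis
    proof (cases "x = y")
      case True
      then show ?thesis
        by (simp only: P Q padd \<phi>_simps) (simp add: \<phi>_simps)
    next
      case False
      then have hxy: "h x \<noteq> h y"
        using inj P(2) Q(2) by (auto dest: inj_onD)
      have "\<phi> (point_add (map_weierstrass \<iota> (short_weierstrass a b)) P Q) = Affine (h (- x - y)) 0"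
        unfolding P(1) Q(1) padd if_not_P[OF False] by (rule \<phi>_simps)
      also have "h (- x - y) = - h x - h y"
        using P(2) Q(2) False unfolding R_def by (rule add)
      also have "Affine (- h x - h y) 0 =
          point_add (map_weierstrass \<iota> (short_weierstrass a' b')) (\<phi> P) (\<phi> Q)"
        unfolding P(1) Q(1) \<phi>_simps padd if_not_P[OF hxy] ..
      finally show ?thesis .
    qed
  qed
  have equiv\<phi>: "\<phi> (map_point \<sigma> P) = map_point \<sigma> (\<phi> P)"
    if "\<sigma> \<in> galois_group \<iota>" "P \<in> insert Infinity ((\<lambda>x. Affine x 0) ` R)" for \<sigma> P
  proof -
    have "\<sigma> 0 = 0"
      using that(1) by (auto simp: galois_group_def field_embedding_0)
    then show ?thesis
      using that equiv by (auto simp: \<phi>_simps R_def)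
  qed
  show ?thesis
    unfolding two_torsion_iso_def T
    by (intro exI[of _ \<phi>] conjI ballI bij\<phi> hom equiv\<phi>)
qed

text \<open>The Tschirnhaus transformation maps the roots of the cubic of \<open>E\<close> onto those of \<open>\<E>\<^bsub>u,v\<^esub>\<close>, and the
  isomorphism sought is given by its inverse. Injectivity uses the condition \<open>N\<close>: if two roots had the same
  image, then \<open>v = u r\<close> for the third root \<open>r\<close>, and \<open>v\<^sup>3 + a u\<^sup>2 v + b u\<^sup>3\<close> would be \<open>u\<^sup>3\<close> times the cubic
  at \<open>r\<close>, that is zero.\<close>

lemma mod2_family_two_torsion_iso:
  fixes \<iota> :: "'a::field \<Rightarrow> 'k::field"
  assumes cl: "separable_closure \<iota>" and two: "(2::'a) \<noteq> 0" and three: "(3::'a) \<noteq> 0"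
    and D: "4 * a^3 + 27 * b^2 \<noteq> 0" and N: "v^3 + a * u^2 * v + b * u^3 \<noteq> 0"
  shows "two_torsion_iso \<iota> (mod2_family a b u v) (short_weierstrass a b)"
proof -
  note emb = separable_closureD(1)[OF cl]
  note \<iota>_simps = field_embedding_simps[OF emb]
  have two': "(2::'k) \<noteq> 0" and three': "(3::'k) \<noteq> 0"
    using two three field_embedding_eq_0_iff[OF emb] field_embedding_numeral[OF emb] by metis+
  define A where "A = 3 * (3 * a * v^2 + 9 * b * u * v - a^2 * u^2)"
  define B where "B = 27 * b * v^3 - 18 * a^2 * u * v^2 - 27 * a * b * u^2 * v - (2 * a^3 + 27 * b^2) * u^3"
  define R where "R = cubic_roots (\<iota> a) (\<iota> b)"
  define S where "S = cubic_roots (\<iota> A) (\<iota> B)"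
  have "\<iota> (4 * a^3 + 27 * b^2) \<noteq> 0"
    using D by (simp only: field_embedding_eq_0_iff[OF emb] not_False_eq_True)
  then have "4 * (\<iota> a)^3 + 27 * (\<iota> b)^2 \<noteq> 0"
    by (simp add: \<iota>_simps)
  from separably_closed_cubic_roots[OF cl this] obtain x y where
    xy: "\<iota> a = - (x^2 + x * y + y^2)" "\<iota> b = x * y * (x + y)"
    by blast
  define h where "h = tschirnhaus (\<iota> a) (\<iota> u) (\<iota> v)"
  have R: "R = {x, y, - x - y}"
    unfolding R_def xy by (rule cubic_roots_of_coefficients)
  have AB: "\<iota> A = - ((h x)^2 + h x * h y + (h y)^2)" "\<iota> B = h x * h y * (h x + h y)"
    unfolding h_def mod2_family_coefficients[OF xy, symmetric] by (simp_all add: A_def B_def \<iota>_simps)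
  have hz: "h (- x - y) = - h x - h y"
    unfolding h_def by (rule tschirnhaus_sum[OF xy(1)])
  have S: "S = h ` R"
    unfolding S_def AB cubic_roots_of_coefficients by (simp add: R hz)
  have third: "- p - q \<in> R" if "p \<in> R" "q \<in> R" "p \<noteq> q" for p q
    using that unfolding R by auto
  have inj: "inj_on h R"
  proof (rule inj_onI, rule ccontr)
    fix p q
    assume pq: "p \<in> R" "q \<in> R" "h p = h q" "p \<noteq> q"
    define r where "r = - p - q"
    have "3 * (p - q) * (\<iota> v - \<iota> u * r) = 0"
      using pq(3) tschirnhaus_diff[of "\<iota> a" "\<iota> u" "\<iota> v" p q] by (simp add: h_def r_def)
    then have v: "\<iota> v = \<iota> u * r"
      using three' pq(4) by simp
    have r: "r^3 + \<iota> a * r + \<iota> b = 0"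
      using third[OF pq(1,2,4)] by (simp add: R_def cubic_roots_def r_def)
    have "\<iota> (v^3 + a * u^2 * v + b * u^3) = (\<iota> u)^3 * (r^3 + \<iota> a * r + \<iota> b)"
      by (simp add: \<iota>_simps v algebra_simps power2_eq_square power3_eq_cube)
    then show False
      using N by (simp only: r field_embedding_eq_0_iff[OF emb] mult_zero_right)
  qed
  have equiv: "h (\<sigma> p) = \<sigma> (h p)" if "\<sigma> \<in> galois_group \<iota>" for \<sigma> p
  proof -
    have hom: "field_embedding \<sigma>" and "\<And>c. \<sigma> (\<iota> c) = \<iota> c"
      using that by (auto simp: galois_group_def)
    then show ?thesis
      by (simp add: h_def tschirnhaus_def field_embedding_simps[OF hom])
  qed
  have add: "h (- p - q) = - h p - h q" if "p \<in> R" "q \<in> R" "p \<noteq> q" for p q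
    using coefficients_of_cubic_roots(1)[of p "\<iota> a" "\<iota> b" q] that tschirnhaus_sum
    unfolding h_def R_def by blast
  define g where "g = the_inv_into R h"
  have hg: "h (g w) = w" "g w \<in> R" if "w \<in> S" for w
    using that inj unfolding S g_def
    by (auto simp: f_the_inv_into_f the_inv_into_f_f)
  have gh: "g (h p) = p" if "p \<in> R" for p
    using that inj by (simp add: g_def the_inv_into_f_f)
  have "two_torsion_iso \<iota> (short_weierstrass A B) (short_weierstrass a b)"
  proof (rule two_torsion_iso_of_roots[OF emb two',
        where h = g and a = A and b = B and a' = a and b' = b, folded R_def S_def])
    show "bij_betw g S R"
      unfolding S g_def using inj by (intro bij_betw_the_inv_into) (simp add: bij_betw_def)
  next
    fix w w'
    assume w: "w \<in> S" "w' \<in> S" "w \<noteq> w'"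
    then have ne': "g w \<noteq> g w'"
      using hg by metis
    have "g (- w - w') = g (- h (g w) - h (g w'))"
      using w hg by simp
    also have "\<dots> = g (h (- g w - g w'))"
      using add[OF hg(2)[OF w(1)] hg(2)[OF w(2)] ne'] by simp
    also have "\<dots> = - g w - g w'"
      by (rule gh[OF third[OF hg(2)[OF w(1)] hg(2)[OF w(2)] ne']])
    finally show "g (- w - w') = - g w - g w'" .
  next
    fix \<sigma> w
    assume \<sigma>: "\<sigma> \<in> galois_group \<iota>" and w: "w \<in> S"
    have "\<sigma> (g w) \<in> R"
      unfolding R_def using galois_cubic_roots[OF \<sigma>] hg(2)[OF w] by (simp add: R_def)
    then have "g (h (\<sigma> (g w))) = \<sigma> (g w)"
      by (rule gh)
    then show "g (\<sigma> w) = \<sigma> (g w)"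
      by (simp only: equiv[OF \<sigma>] hg(1)[OF w])
  qed
  then show ?thesis
    by (simp add: mod2_family_def A_def B_def)
qed

text \<open>Completing the square in \<open>y\<close> and the cube in \<open>x\<close>. The five equations are those of a change of variables
  with scaling factor \<open>1\<close> to the short curve with coefficients \<open>A\<close> and \<open>B\<close>.\<close>

lemma short_weierstrass_model:
  fixes W :: "'a::field weierstrass"
  assumes two: "(2::'a) \<noteq> 0" and three: "(3::'a) \<noteq> 0"
  obtains r s t A B where
     "0 = wa1 W + 2 * s"
     "0 = wa2 W - s * wa1 W + 3 * r - s^2"
     "0 = wa3 W + r * wa1 W + 2 * t"
     "A = wa4 W - s * wa3 W + 2 * r * wa2 W - (t + r * s) * wa1 W
                    + 3 * r^2 - 2 * s * t"
     "B = wa6 W + r * wa4 W + r^2 * wa2 W + r^3 - t * wa3 W - t^2 - r * t * wa1 W"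
proof -
  define s where "s = - wa1 W / 2"
  define r where "r = - (wa2 W - s * wa1 W - s^2) / 3"
  define t where "t = - (wa3 W + r * wa1 W) / 2"
  have "2 * s = - wa1 W" "3 * r = - (wa2 W - s * wa1 W - s^2)" "2 * t = - (wa3 W + r * wa1 W)"
    using two three by (simp_all add: s_def r_def t_def)
  then have "0 = wa1 W + 2 * s" "0 = wa2 W - s * wa1 W + 3 * r - s^2" "0 = wa3 W + r * wa1 W + 2 * t"
    by simp_all
  from that[OF this refl refl] show thesis .
qed

text \<open>In the coordinates of the short model the nonzero 2-torsion points are those with second
  coordinate \<open>0\<close>; so on the original curve they are determined by a root of the short cubic.\<close>

lemma two_torsion_short_model:
  fixes \<iota> :: "'a::field \<Rightarrow> 'k::field" and W :: "'a weierstrass"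
  assumes emb: "field_embedding \<iota>" and two: "(2::'k) \<noteq> 0"
    and model: "0 = wa1 W + 2 * s" "0 = wa2 W - s * wa1 W + 3 * r - s^2"
     "0 = wa3 W + r * wa1 W + 2 * t"
     "A = wa4 W - s * wa3 W + 2 * r * wa2 W - (t + r * s) * wa1 W + 3 * r^2 - 2 * s * t"
     "B = wa6 W + r * wa4 W + r^2 * wa2 W + r^3 - t * wa3 W - t^2 - r * t * wa1 W"
    and P: "Affine x y \<in> two_torsion \<iota> W"
  shows "x - \<iota> r \<in> cubic_roots (\<iota> A) (\<iota> B)" "y = \<iota> s * (x - \<iota> r) + \<iota> t"
proof -
  define W' where "W' = map_weierstrass \<iota> W"
  define V where "V = map_weierstrass \<iota> (short_weierstrass A B)"
  have W': "wa1 W' = \<iota> (wa1 W)" "wa2 W' = \<iota> (wa2 W)" "wa3 W' = \<iota> (wa3 W)"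
    "wa4 W' = \<iota> (wa4 W)" "wa6 W' = \<iota> (wa6 W)"
    by (simp_all add: W'_def weierstrass.map_sel)
  have V: "wa1 V = 0" "wa2 V = 0" "wa3 V = 0" "wa4 V = \<iota> A" "wa6 V = \<iota> B"
    by (simp_all add: V_def short_weierstrass_def field_embedding_0[OF emb])
  note \<iota>_simps = field_embedding_simps[OF emb]
  have model':
    "1 * wa1 V = wa1 W' + 2 * \<iota> s"
    "1^2 * wa2 V = wa2 W' - \<iota> s * wa1 W' + 3 * \<iota> r - (\<iota> s)^2"
    "1^3 * wa3 V = wa3 W' + \<iota> r * wa1 W' + 2 * \<iota> t"
    "1^4 * wa4 V = wa4 W' - \<iota> s * wa3 W' + 2 * \<iota> r * wa2 W' - (\<iota> t + \<iota> r * \<iota> s) * wa1 W'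
       + 3 * (\<iota> r)^2 - 2 * \<iota> s * \<iota> t"
    "1^6 * wa6 V = wa6 W' + \<iota> r * wa4 W' + (\<iota> r)^2 * wa2 W' + (\<iota> r)^3 - \<iota> t * wa3 W' - (\<iota> t)^2
       - \<iota> r * \<iota> t * wa1 W'"
    using arg_cong[OF model(1), of \<iota>] arg_cong[OF model(2), of \<iota>] arg_cong[OF model(3), of \<iota>]
      arg_cong[OF model(4), of \<iota>] arg_cong[OF model(5), of \<iota>]
    unfolding V W' by (simp_all only: \<iota>_simps power_one mult_1_left)
  have on: "on_curve W' x y" and tors: "2 * y + wa1 W' * x + wa3 W' = 0"
    using P by (auto simp: two_torsion_eq W'_def)
  define x0 where "x0 = x - \<iota> r"
  define y0 where "y0 = y - \<iota> s * x0 - \<iota> t"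
  have x: "x = 1^2 * x0 + \<iota> r" and y: "y = 1^3 * y0 + \<iota> s * 1^2 * x0 + \<iota> t"
    by (simp_all add: x0_def y0_def)
  have "2 * y0 = (2 * y + wa1 W' * x + wa3 W') - (wa1 W' + 2 * \<iota> s) * x0
      - (wa3 W' + \<iota> r * wa1 W' + 2 * \<iota> t)"
    by (simp add: x0_def y0_def algebra_simps)
  also have "\<dots> = 0"
    using tors model'(1,3) by (simp add: V)
  finally have "y0 = 0"
    using two by simp
  then show "y = \<iota> s * (x - \<iota> r) + \<iota> t"
    by (simp add: y0_def x0_def algebra_simps)
  have "y^2 + wa1 W' * x * y + wa3 W' * y - (x^3 + wa2 W' * x^2 + wa4 W' * x + wa6 W') = 0"
    using on by (simp add: on_curve_def)
  then have "- (x0^3 + \<iota> A * x0 + \<iota> B) = 0"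
    unfolding x y weierstrass_substitution[OF model'] using \<open>y0 = 0\<close>
    by (simp add: V algebra_simps)
  then have "x0^3 + \<iota> A * x0 + \<iota> B = 0"
    by (simp only: neg_equal_0_iff_equal)
  then show "x - \<iota> r \<in> cubic_roots (\<iota> A) (\<iota> B)"
    by (simp add: cubic_roots_def x0_def)
qed

section \<open>Curves with isomorphic 2-torsion\<close>

text \<open>The numbers \<open>u\<close> and \<open>v\<close> are found by interpolation. An automorphism carries the polynomial
  \<open>h\<close> with parameters \<open>u\<close>, \<open>v\<close> to the one with parameters \<open>\<sigma> u\<close>, \<open>\<sigma> v\<close>; by equivariance both take the same
  values at all roots, so they agree and the parameters are fixed by the Galois group.\<close>

lemma equivariant_root_map_is_tschirnhaus:
  fixes \<iota> :: "'a::field \<Rightarrow> 'k::field"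
  assumes cl: "separable_closure \<iota>" and three: "(3::'k) \<noteq> 0"
    and a: "\<iota> a = - (x^2 + x * y + y^2)" and b: "\<iota> b = x * y * (x + y)"
    and ne: "x \<noteq> y" "x \<noteq> - x - y" "y \<noteq> - x - y"
    and sum: "g (- x - y) = - g x - g y"
    and equiv: "\<And>\<sigma> p. \<sigma> \<in> galois_group \<iota> \<Longrightarrow> p \<in> cubic_roots (\<iota> a) (\<iota> b) \<Longrightarrow> g (\<sigma> p) = \<sigma> (g p)"
  shows "\<exists>u v. \<forall>p \<in> cubic_roots (\<iota> a) (\<iota> b). g p = tschirnhaus (\<iota> a) (\<iota> u) (\<iota> v) p"
proof -
  define z where "z = - x - y"
  define R where "R = cubic_roots (\<iota> a) (\<iota> b)"
  have R: "R = {x, y, z}"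
    unfolding R_def a b z_def by (rule cubic_roots_of_coefficients)
  have xz: "x - z \<noteq> 0" and yz: "y - z \<noteq> 0" and xy: "x - y \<noteq> 0"
    using ne unfolding z_def by (simp_all only: right_minus_eq not_False_eq_True)
  have z_alt: "y = - x - z"
    by (simp add: z_def)
  \<comment> \<open>solves \<open>v - u z = p\<close> and \<open>v - u y = q\<close>, which \<open>tschirnhaus_diff\<close> prescribes for the differences of values of \<open>g\<close>\<close>
  define p where "p = (g x - g y) / (3 * (x - y))"
  define q where "q = (g x - g z) / (3 * (x - z))"
  define u where "u = (p - q) / (y - z)"
  define v where "v = p + u * z"
  define h where "h = tschirnhaus (\<iota> a) u v"
  have hz: "h z = - h x - h y" and gz: "g z = - g x - g y"
    unfolding h_def z_def by (rule tschirnhaus_sum[OF a]) (rule sum)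
  have d1: "h x - h y = g x - g y"
  proof -
    have "h x - h y = 3 * (x - y) * (v - u * z)"
      unfolding h_def z_def by (rule tschirnhaus_diff)
    also have "v - u * z = p"
      by (simp add: v_def)
    finally show ?thesis
      using xy three by (simp add: p_def)
  qed
  have d2: "h x - h z = g x - g z"
  proof -
    have "h x - h z = 3 * (x - z) * (v - u * y)"
      unfolding h_def by (subst z_alt) (rule tschirnhaus_diff)
    also have "v - u * y = p - u * (y - z)"
      by (simp add: v_def algebra_simps)
    also have "\<dots> = q"
      using yz by (simp add: u_def)
    finally show ?thesis
      using xz three by (simp add: q_def)
  qed
  \<comment> \<open>the differences agree, and both triples of values sum to zero\<close>
  have "3 * (h x - g x) = ((h x - h y) - (g x - g y)) + ((h x - h z) - (g x - g z))"
    by (simp add: hz gz algebra_simps)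
  also have "\<dots> = 0"
    by (simp add: d1 d2)
  finally have gx: "g x = h x"
    using three by simp
  moreover have "g y = h y" "g z = h z"
    using d1 d2 unfolding gx by simp_all
  ultimately have gh: "g p = h p" if "p \<in> R" for p
    using that unfolding R by blast
  have fixed: "\<sigma> u = u \<and> \<sigma> v = v" if \<sigma>: "\<sigma> \<in> galois_group \<iota>" for \<sigma>
  proof -
    have hom: "field_embedding \<sigma>" and inj: "inj \<sigma>" and fix_base: "\<And>c. \<sigma> (\<iota> c) = \<iota> c"
      using \<sigma> by (auto simp: galois_group_def bij_def)
    have "\<sigma> ` R \<subseteq> R"
      unfolding R_def by (rule image_subsetI) (rule galois_cubic_roots[OF \<sigma>])
    moreover have "finite R"
      unfolding R by (intro finite.intros)
    ultimately have surj: "\<sigma> ` R = R"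
      using inj_on_subset[OF inj subset_UNIV] endo_inj_surj by blast
    define h' where "h' = tschirnhaus (\<iota> a) (\<sigma> u) (\<sigma> v)"
    have h'h: "h' p = h p" if "p \<in> R" for p
    proof -
      have "p \<in> \<sigma> ` R"
        unfolding surj by (rule that)
      then obtain r where r: "r \<in> R" "p = \<sigma> r"
        by (elim imageE)
      have "h' (\<sigma> r) = \<sigma> (h r)"
        by (simp add: h'_def h_def tschirnhaus_def field_embedding_simps[OF hom] fix_base)
      also have "\<dots> = \<sigma> (g r)"
        using gh[OF r(1)] by simp
      also have "\<dots> = g (\<sigma> r)"
        using equiv[OF \<sigma>] r(1) by (simp add: R_def)
      also have "\<dots> = h (\<sigma> r)"
        using gh that r(2) by simp
      finally show ?thesis
        by (simp add: r(2))
    qed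
    have "\<sigma> v - \<sigma> u * z = v - u * z"
    proof -
      have "3 * (x - y) * (\<sigma> v - \<sigma> u * z) = h' x - h' y"
        unfolding h'_def z_def by (rule tschirnhaus_diff[symmetric])
      also have "\<dots> = h x - h y"
        using h'h[of x] h'h[of y] by (simp add: R)
      also have "\<dots> = 3 * (x - y) * (v - u * z)"
        unfolding h_def z_def by (rule tschirnhaus_diff)
      finally show ?thesis
        using three xy by simp
    qed
    moreover have "\<sigma> v - \<sigma> u * y = v - u * y"
    proof -
      have "3 * (x - z) * (\<sigma> v - \<sigma> u * y) = h' x - h' z"
        unfolding h'_def by (subst z_alt) (rule tschirnhaus_diff[symmetric])
      also have "\<dots> = h x - h z"
        using h'h[of x] h'h[of z] by (simp add: R)
      also have "\<dots> = 3 * (x - z) * (v - u * y)"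
        unfolding h_def by (subst z_alt) (rule tschirnhaus_diff)
      finally show ?thesis
        using three xz by simp
    qed
    ultimately have "(\<sigma> v - \<sigma> u * z) - (\<sigma> v - \<sigma> u * y) = (v - u * z) - (v - u * y)"
      by simp
    then have "(\<sigma> u - u) * (y - z) = 0"
      by (simp add: algebra_simps)
    then have "\<sigma> u = u"
      using yz by simp
    with \<open>\<sigma> v - \<sigma> u * z = v - u * z\<close> show ?thesis
      by simp
  qed
  obtain u0 v0 where "u = \<iota> u0" "v = \<iota> v0"
    using galois_group_fixed_field[OF cl, of u] galois_group_fixed_field[OF cl, of v] fixed by blast
  then show ?thesis
    using gh unfolding h_def R_def by blast
qed

text \<open>The inverse of the given isomorphism sends \<open>(e, 0)\<close> to a point of \<open>W\<close>; \<open>g e\<close> is the first coordinate of that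
  point in a short model of \<open>W\<close>. The roots of the short cubic are then Tschirnhaus transforms of those of \<open>E\<close>, so
  the short model is a member of the family itself, with no further twist.\<close>

lemma two_torsion_iso_imp_mod2_family:
  fixes \<iota> :: "'a::field \<Rightarrow> 'k::field"
  assumes cl: "separable_closure \<iota>" and two: "(2::'a) \<noteq> 0" and three: "(3::'a) \<noteq> 0"
    and D: "4 * a^3 + 27 * b^2 \<noteq> 0"
    and iso: "two_torsion_iso \<iota> W (short_weierstrass a b)"
  shows "\<exists>u v. weierstrass_iso W (mod2_family a b u v)"
proof -
  note emb = separable_closureD(1)[OF cl]
  note \<iota>_simps = field_embedding_simps[OF emb]
  have two': "(2::'k) \<noteq> 0" and three': "(3::'k) \<noteq> 0"
    using two three field_embedding_eq_0_iff[OF emb] field_embedding_numeral[OF emb] by metis+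
  have "\<iota> (4 * a^3 + 27 * b^2) \<noteq> 0"
    using D by (simp only: field_embedding_eq_0_iff[OF emb] not_False_eq_True)
  then have "4 * (\<iota> a)^3 + 27 * (\<iota> b)^2 \<noteq> 0"
    by (simp add: \<iota>_simps)
  from separably_closed_cubic_roots[OF cl this] obtain x y where
    xy: "\<iota> a = - (x^2 + x * y + y^2)" "\<iota> b = x * y * (x + y)"
    and ne: "x \<noteq> y" "x \<noteq> - x - y" "y \<noteq> - x - y"
    by blast
  define R where "R = cubic_roots (\<iota> a) (\<iota> b)"
  have R: "R = {x, y, - x - y}"
    unfolding R_def xy by (rule cubic_roots_of_coefficients)
  obtain r s t A B where model:
     "0 = wa1 W + 2 * s" "0 = wa2 W - s * wa1 W + 3 * r - s^2"
     "0 = wa3 W + r * wa1 W + 2 * t"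
     "A = wa4 W - s * wa3 W + 2 * r * wa2 W - (t + r * s) * wa1 W + 3 * r^2 - 2 * s * t"
     "B = wa6 W + r * wa4 W + r^2 * wa2 W + r^3 - t * wa3 W - t^2 - r * t * wa1 W"
    using short_weierstrass_model[OF two three] .
  note short = two_torsion_short_model[OF emb two' model]
  define T where "T = two_torsion \<iota> W"
  define T' where "T' = two_torsion \<iota> (short_weierstrass a b)"
  have T': "T' = insert Infinity ((\<lambda>x. Affine x 0) ` R)"
    unfolding T'_def R_def by (rule two_torsion_short_weierstrass[OF emb two'])
  obtain \<phi> where bij: "bij_betw \<phi> T T'"
    and hom: "\<And>P Q. P \<in> T \<Longrightarrow> Q \<in> T \<Longrightarrow> \<phi> (point_add (map_weierstrass \<iota> W) P Q)
          = point_add (map_weierstrass \<iota> (short_weierstrass a b)) (\<phi> P) (\<phi> Q)"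
    and equiv: "\<And>\<sigma> P. \<sigma> \<in> galois_group \<iota> \<Longrightarrow> P \<in> T \<Longrightarrow> \<phi> (map_point \<sigma> P) = map_point \<sigma> (\<phi> P)"
    using iso unfolding two_torsion_iso_def T_def T'_def by blast
  have InfT: "Infinity \<in> T"
    by (simp add: T_def two_torsion_eq)
  have "\<phi> Infinity \<in> T'"
    using bij InfT by (auto simp: bij_betw_def)
  then have "point_add (map_weierstrass \<iota> (short_weierstrass a b)) (\<phi> Infinity) (\<phi> Infinity) = Infinity"
    by (simp add: T'_def two_torsion_def)
  then have \<phi>_Inf: "\<phi> Infinity = Infinity"
    using hom[OF InfT InfT] by simp
  have inj: "inj_on \<phi> T" and im: "\<phi> ` T = T'"
    using bij by (auto simp: bij_betw_def)
  have ex: "\<exists>c d. Affine c d \<in> T \<and> \<phi> (Affine c d) = Affine e 0" if "e \<in> R" for e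
  proof -
    have "Affine e 0 \<in> \<phi> ` T"
      using that unfolding im T' by blast
    then obtain P where P: "P \<in> T" "\<phi> P = Affine e 0"
      by force
    then have "P \<noteq> Infinity"
      using \<phi>_Inf by auto
    then show ?thesis
      using P by (cases P) auto
  qed
  \<comment> \<open>the point of \<open>W\<close> that corresponds to the point \<open>(w, 0)\<close> of the short model\<close>
  define pt where "pt w = Affine (w + \<iota> r) (\<iota> s * w + \<iota> t)" for w
  have "\<exists>w. w \<in> cubic_roots (\<iota> A) (\<iota> B) \<and> pt w \<in> T \<and> \<phi> (pt w) = Affine e 0" if e: "e \<in> R" for e
  proof -
    obtain c d where cd: "Affine c d \<in> T" "\<phi> (Affine c d) = Affine e 0"
      using ex[OF e] by blast
    then have "c - \<iota> r \<in> cubic_roots (\<iota> A) (\<iota> B)" "pt (c - \<iota> r) = Affine c d"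
      using short[of c d] by (simp_all add: T_def pt_def)
    then show ?thesis
      using cd by metis
  qed
  then obtain g where g: "\<And>e. e \<in> R \<Longrightarrow> g e \<in> cubic_roots (\<iota> A) (\<iota> B)"
    "\<And>e. e \<in> R \<Longrightarrow> pt (g e) \<in> T" "\<And>e. e \<in> R \<Longrightarrow> \<phi> (pt (g e)) = Affine e 0"
    by metis
  have g_inj: "g e \<noteq> g e'" if "e \<in> R" "e' \<in> R" "e \<noteq> e'" for e e'
    using g(3)[OF that(1)] g(3)[OF that(2)] that(3) by auto
  have g_equiv: "g (\<sigma> e) = \<sigma> (g e)" if \<sigma>: "\<sigma> \<in> galois_group \<iota>" and e: "e \<in> R" for \<sigma> e
  proof -
    have \<sigma>hom: "field_embedding \<sigma>" and fix_base: "\<And>c. \<sigma> (\<iota> c) = \<iota> c"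
      using \<sigma> by (auto simp: galois_group_def)
    have e': "\<sigma> e \<in> R"
      using galois_cubic_roots[OF \<sigma>] e by (simp add: R_def)
    have map_pt: "map_point \<sigma> (pt (g e)) = pt (\<sigma> (g e))"
      by (simp add: pt_def field_embedding_simps[OF \<sigma>hom] fix_base)
    have "map_point \<sigma> (pt (g e)) \<in> T"
    proof -
      obtain c d where cd: "pt (g e) = Affine c d"
        by (simp add: pt_def)
      have on: "on_curve (map_weierstrass \<iota> W) c d"
        "2 * d + wa1 (map_weierstrass \<iota> W) * c + wa3 (map_weierstrass \<iota> W) = 0"
        using g(2)[OF e] unfolding cd T_def two_torsion_eq by auto
      have "on_curve (map_weierstrass \<iota> W) (\<sigma> c) (\<sigma> d)"
        using arg_cong[OF on(1)[unfolded on_curve_def], of \<sigma>]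
        by (simp add: on_curve_def weierstrass.map_sel field_embedding_simps[OF \<sigma>hom] fix_base)
      moreover have "2 * \<sigma> d + wa1 (map_weierstrass \<iota> W) * \<sigma> c + wa3 (map_weierstrass \<iota> W) = 0"
        using arg_cong[OF on(2), of \<sigma>]
        by (simp add: weierstrass.map_sel field_embedding_simps[OF \<sigma>hom] fix_base)
      ultimately show ?thesis
        by (simp add: cd T_def two_torsion_eq)
    qed
    moreover have "\<phi> (map_point \<sigma> (pt (g e))) = \<phi> (pt (g (\<sigma> e)))"
      using equiv[OF \<sigma> g(2)[OF e]] g(3)[OF e] g(3)[OF e'] by (simp add: field_embedding_0[OF \<sigma>hom])
    ultimately have "pt (\<sigma> (g e)) = pt (g (\<sigma> e))"
      using inj g(2)[OF e'] unfolding map_pt by (auto dest: inj_onD)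
    then show ?thesis
      by (simp add: pt_def)
  qed
  have gxy: "g x \<noteq> g y" "g x \<noteq> g (- x - y)" "g y \<noteq> g (- x - y)"
    by (rule g_inj; use ne in \<open>simp only: R insert_iff simp_thms\<close>)+
  note AB = coefficients_of_cubic_roots[OF g(1)[of x] g(1)[of y] gxy(1)]
  have AB': "\<iota> A = - ((g x)^2 + g x * g y + (g y)^2)" "\<iota> B = g x * g y * (g x + g y)"
    using AB by (simp_all add: R)
  have "g (- x - y) \<in> cubic_roots (\<iota> A) (\<iota> B)"
    by (rule g(1)) (simp add: R)
  then have sum: "g (- x - y) = - g x - g y"
    unfolding AB' cubic_roots_of_coefficients using gxy by auto
  obtain u v where gres: "\<And>p. p \<in> R \<Longrightarrow> g p = tschirnhaus (\<iota> a) (\<iota> u) (\<iota> v) p"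
    using equivariant_root_map_is_tschirnhaus[OF cl three' xy ne sum g_equiv[unfolded R_def]]
    unfolding R_def by blast
  define A' where "A' = 3 * (3 * a * v^2 + 9 * b * u * v - a^2 * u^2)"
  define B' where "B' = 27 * b * v^3 - 18 * a^2 * u * v^2 - 27 * a * b * u^2 * v - (2 * a^3 + 27 * b^2) * u^3"
  have gg: "g x = tschirnhaus (\<iota> a) (\<iota> u) (\<iota> v) x" "g y = tschirnhaus (\<iota> a) (\<iota> u) (\<iota> v) y"
    by (rule gres, simp add: R)+
  have "\<iota> A = \<iota> A'" "\<iota> B = \<iota> B'"
    unfolding AB' gg mod2_family_coefficients[OF xy, symmetric]
    by (simp_all add: A'_def B'_def \<iota>_simps)
  then have "A = A'" "B = B'"
    by (simp_all add: field_embedding_eq_iff[OF emb])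
  then have fam: "mod2_family a b u v = short_weierstrass A B"
    by (simp add: mod2_family_def A'_def B'_def)
  have "weierstrass_iso W (short_weierstrass A B)"
    unfolding weierstrass_iso_def
  proof (intro exI conjI)
    show "(1::'a) \<noteq> 0"
      by simp
    show "1 * wa1 (short_weierstrass A B) = wa1 W + 2 * s"
      "1^2 * wa2 (short_weierstrass A B) = wa2 W - s * wa1 W + 3 * r - s^2"
      "1^3 * wa3 (short_weierstrass A B) = wa3 W + r * wa1 W + 2 * t"
      "1^4 * wa4 (short_weierstrass A B) = wa4 W - s * wa3 W + 2 * r * wa2 W - (t + r * s) * wa1 W
                    + 3 * r^2 - 2 * s * t"
      "1^6 * wa6 (short_weierstrass A B) = wa6 W + r * wa4 W + r^2 * wa2 W + r^3 - t * wa3 W - t^2 - r * t * wa1 W"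
      using model by (simp_all only: short_weierstrass_def weierstrass.sel power_one mult_1_left)
  qed
  then show ?thesis
    unfolding fam[symmetric] by blast
qed

section \<open>Invariants of the family and the theorem\<close>

lemma discriminant_mod2_family:
  fixes a b u v :: "'a::field"
  shows "discriminant (mod2_family a b u v) =
          3^6 * (v^3 + a * u^2 * v + b * u^3)^2 * discriminant (short_weierstrass a b)"
  unfolding mod2_family_def discriminant_short_weierstrass mod2_family_cubic_discriminant
  by (simp only: mult_ac)

lemma j_invariant_short_weierstrass:
  fixes a b :: "'a::field"
  assumes "(2::'a) \<noteq> 0"
  shows "j_invariant (short_weierstrass a b) = 6912 * a^3 / (4 * a^3 + 27 * b^2)"
proof -
  have "wc4 (short_weierstrass a b) ^ 3 = -16 * (6912 * a^3)"
    unfolding wc4_def wb2_def wb4_def short_weierstrass_def by (simp add: power_mult_distrib)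
  then have "j_invariant (short_weierstrass a b) = (-16 * (6912 * a^3)) / (-16 * (4 * a^3 + 27 * b^2))"
    by (simp only: j_invariant_def discriminant_short_weierstrass)
  also have "\<dots> = 6912 * a^3 / (4 * a^3 + 27 * b^2)"
    using assms power_not_zero[of "2::'a" 4] by (intro mult_divide_mult_cancel_left) simp
  finally show ?thesis .
qed

lemma j_invariant_mod2_family:
  fixes a b u v :: "'a::field"
  assumes two: "(2::'a) \<noteq> 0" and three: "(3::'a) \<noteq> 0"
  shows "j_invariant (mod2_family a b u v) =
          (3 * a * v^2 + 9 * b * u * v - a^2 * u^2)^3 * j_over_a_cubed a b
          / (27 * (v^3 + a * u^2 * v + b * u^3)^2)"
proof -
  define T where "T = 3 * a * v^2 + 9 * b * u * v - a^2 * u^2"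
  define N where "N = v^3 + a * u^2 * v + b * u^3"
  define D where "D = 4 * a^3 + 27 * b^2"
  have 27: "(27::'a) \<noteq> 0"
    using power_not_zero[OF three, of 3] by simp
  have "j_invariant (mod2_family a b u v) = 6912 * (3 * T)^3 / (3^6 * N^2 * D)"
    unfolding mod2_family_def j_invariant_short_weierstrass[OF two] mod2_family_cubic_discriminant
    by (simp only: T_def N_def D_def)
  also have "\<dots> = (27 * (T^3 * 6912)) / (27 * (27 * N^2 * D))"
    by (simp add: power_mult_distrib mult_ac)
  also have "\<dots> = (T^3 * 6912) / (27 * N^2 * D)"
    by (rule mult_divide_mult_cancel_left[OF 27])
  also have "\<dots> = T^3 * (6912 / D) / (27 * N^2)"
    by simp
  finally show ?thesis
    by (simp only: j_over_a_cubed_def T_def N_def D_def)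
qed

lemma of_nat_neq_0_if_CHAR_neq:
  assumes "CHAR('a::field) \<noteq> n" "prime n"
  shows "(of_nat n :: 'a) \<noteq> 0"
proof
  assume "(of_nat n :: 'a) = 0"
  then have "CHAR('a) dvd n"
    by (simp add: of_nat_eq_0_iff_char_dvd)
  then show False
    using assms by (metis CHAR_not_1' One_nat_def prime_nat_iff)
qed

theorem theorem1:
  fixes \<iota> :: "'a::field \<Rightarrow> 'k::field"
    and a b :: 'a
  assumes "separable_closure \<iota>"
    and "CHAR('a) \<noteq> 2" and "CHAR('a) \<noteq> 3"
    and "nonsingular (short_weierstrass a b)"
  shows
    "(\<forall>E' :: 'a weierstrass.
        nonsingular E' \<longrightarrow> two_torsion_iso \<iota> E' (short_weierstrass a b) \<longrightarrow>
        (\<exists>u v. weierstrass_iso E' (mod2_family a b u v))) \<and>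
     (\<forall>u v :: 'a.
        nonsingular (mod2_family a b u v) \<longrightarrow>
        two_torsion_iso \<iota> (mod2_family a b u v) (short_weierstrass a b) \<and>
        (a \<noteq> 0 \<longrightarrow>
           j_invariant (mod2_family a b u v) =
             (3 * a * v^2 + 9 * b * u * v - a^2 * u^2)^3 * j_invariant (short_weierstrass a b)
             / (27 * a^3 * (v^3 + a * u^2 * v + b * u^3)^2)) \<and>
        j_invariant (mod2_family a b u v) =
          (3 * a * v^2 + 9 * b * u * v - a^2 * u^2)^3 * j_over_a_cubed a b
          / (27 * (v^3 + a * u^2 * v + b * u^3)^2) \<and>
        discriminant (mod2_family a b u v) =
          3^6 * (v^3 + a * u^2 * v + b * u^3)^2 * discriminant (short_weierstrass a b))"
proof -
  have two: "(2::'a) \<noteq> 0" and three: "(3::'a) \<noteq> 0"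
    using of_nat_neq_0_if_CHAR_neq[OF assms(2)] of_nat_neq_0_if_CHAR_neq[OF assms(3)] by simp_all
  have D: "4 * a^3 + 27 * b^2 \<noteq> 0"
    by (rule nonsingular_short_weierstrass[OF two three assms(4)])
  show ?thesis
  proof (intro conjI allI impI)
    fix E' :: "'a weierstrass"
    assume "two_torsion_iso \<iota> E' (short_weierstrass a b)"
    then show "\<exists>u v. weierstrass_iso E' (mod2_family a b u v)"
      by (rule two_torsion_iso_imp_mod2_family[OF assms(1) two three D])
  next
    fix u v :: 'a
    assume ns: "nonsingular (mod2_family a b u v)"
    note D' = nonsingular_short_weierstrass[OF two three ns[unfolded mod2_family_def]]
    have N: "v^3 + a * u^2 * v + b * u^3 \<noteq> 0"
    proof
      assume "v^3 + a * u^2 * v + b * u^3 = 0"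
      then show False
        using D' unfolding mod2_family_cubic_discriminant by simp
    qed
    show "two_torsion_iso \<iota> (mod2_family a b u v) (short_weierstrass a b)"
      by (rule mod2_family_two_torsion_iso[OF assms(1) two three D N])
    show j: "j_invariant (mod2_family a b u v) =
          (3 * a * v^2 + 9 * b * u * v - a^2 * u^2)^3 * j_over_a_cubed a b
          / (27 * (v^3 + a * u^2 * v + b * u^3)^2)"
      by (rule j_invariant_mod2_family[OF two three])
    show "j_invariant (mod2_family a b u v) =
             (3 * a * v^2 + 9 * b * u * v - a^2 * u^2)^3 * j_invariant (short_weierstrass a b)
             / (27 * a^3 * (v^3 + a * u^2 * v + b * u^3)^2)" if "a \<noteq> 0"
      unfolding j j_over_a_cubed[OF two that] by (simp add: mult_ac)
    show "discriminant (mod2_family a b u v) =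
          3^6 * (v^3 + a * u^2 * v + b * u^3)^2 * discriminant (short_weierstrass a b)"
      by (rule discriminant_mod2_family)
  qed
qed

end
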